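(* For any good map $T_g:[0,1]\to[0,1]$ the following hold. (1) $T_g$ admits an invariant probability measure $\mu_g$ that is mixing and absolutely continuous with respect to Lebesgue measure $\lambda$. (2) There exists a constant $a>0$ such that for each $f\in L^\infty(\mu_g)$ and each function $h:[0,1]\to\mathbb R$ of bounded variation we have $$|Cor_{\mu_g,n}(f,h)|=O(e^{-an}),$$ where $Cor_{\mu_g,n}(f,h)=\int f\circ T_g^n\cdot h\,d\mu_g-\int f\,d\mu_g\cdot\int h\,d\mu_g$.
   Context: A map $T_g:[0,1]\to[0,1]$ is called good if, for some real $r_g\ge 1$, $T_g(x)=1-2^{r_g}(\frac12-x)^{r_g}$ for $x\in[0,\frac12)$ and $T_g(x)=2x-1$ for $x\in[\frac12,1]$. *)

theory Defs
  imports "HOL-Probability.Probability" "HOL-Library.Landau_Symbols"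
begin

text \<open>Self-maps of \<open>[0,1]\<close> are functions on the reals, and only their values on \<open>{0..1}\<close> matter.
  On the first branch the base \<open>1/2 - x\<close> is positive, so \<open>powr\<close> is the usual real power.\<close>

definition good_map :: "(real \<Rightarrow> real) \<Rightarrow> bool" where
  "good_map T \<longleftrightarrow> T \<in> {0..1} \<rightarrow> {0..1} \<and>
     (\<exists>r::real. r \<ge> 1 \<and>
        (\<forall>x\<in>{0..<1/2}. T x = 1 - 2 powr r * (1/2 - x) powr r) \<and>
        (\<forall>x\<in>{1/2..1}. T x = 2 * x - 1))"

abbreviation unit_borel :: "real measure" where
  "unit_borel \<equiv> restrict_space borel {0..1}"

abbreviation unit_lebesgue :: "real measure" where
  "unit_lebesgue \<equiv> restrict_space lborel {0..1}"

text \<open>The measurability conjunct is needed because \<open>distr\<close> is only the push-forward for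
  measurable maps.\<close>

definition invariant_measure :: "'a measure \<Rightarrow> ('a \<Rightarrow> 'a) \<Rightarrow> bool" where
  "invariant_measure M T \<longleftrightarrow> T \<in> measurable M M \<and> distr M M T = M"

definition mixing :: "'a measure \<Rightarrow> ('a \<Rightarrow> 'a) \<Rightarrow> bool" where
  "mixing M T \<longleftrightarrow> (\<forall>A\<in>sets M. \<forall>B\<in>sets M.
     (\<lambda>n. measure M (((T ^^ n) -` A \<inter> space M) \<inter> B)) \<longlonglongrightarrow> measure M A * measure M B)"

definition in_Linfty :: "'a measure \<Rightarrow> ('a \<Rightarrow> real) \<Rightarrow> bool" where
  "in_Linfty M f \<longleftrightarrow> f \<in> borel_measurable M \<and> esssup M (\<lambda>x. ereal \<bar>f x\<bar>) < \<infinity>"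

definition bounded_variation_on :: "real \<Rightarrow> real \<Rightarrow> (real \<Rightarrow> real) \<Rightarrow> bool" where
  "bounded_variation_on a b h \<longleftrightarrow> (\<exists>V. \<forall>(n::nat) t.
     mono_on {..n} t \<and> t ` {..n} \<subseteq> {a..b} \<longrightarrow> (\<Sum>i<n. \<bar>h (t (Suc i)) - h (t i)\<bar>) \<le> V)"

definition Cor :: "'a measure \<Rightarrow> ('a \<Rightarrow> 'a) \<Rightarrow> nat \<Rightarrow> ('a \<Rightarrow> real) \<Rightarrow> ('a \<Rightarrow> real) \<Rightarrow> real" where
  "Cor M T n f h = (\<integral>x. f ((T ^^ n) x) * h x \<partial>M) - (\<integral>x. f x \<partial>M) * (\<integral>x. h x \<partial>M)"

end

theory Submission
  imports Defs
begin

text \<open>In the coordinate \<open>x = 1 - w powr r\<close> the map has two full branches with inverses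
  \<open>w \<mapsto> p * w\<close> and \<open>w \<mapsto> ((1 + w) / 2) powr s\<close>, where \<open>s = 1 / r\<close> and \<open>p = 2 powr (- s)\<close>. Both are
  increasing with nonincreasing derivative, so the transfer operator preserves nonnegative
  decreasing functions. For decreasing probability densities with a fixed bound at \<open>0\<close>, a fixed
  power of the operator exceeds a constant \<open>\<epsilon>\<close>; subtracting \<open>\<epsilon>\<close> leaves a multiple of a density
  of the same kind, and iterating this gives uniform exponential contraction. The fixed density
  \<open>\<rho>\<close> is decreasing, and an increasing observable in \<open>x\<close> becomes a decreasing one in \<open>w\<close>, so
  its product with \<open>\<rho>\<close> is, up to normalisation, again such a density. A function of bounded
  variation is a difference of two increasing ones, and indicators of rays suffice for mixing.\<close>

subsection \<open>Bounded variation and mixing\<close>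

text \<open>Jordan decomposition with \<open>h1\<close> the total variation \<open>V\<close> of
  \<open>h\<close> on \<open>{a..x}\<close> and \<open>h2 = V - h\<close>. The identity is then
  trivial at every real point, so it may later be used as an equality of functions.\<close>

lemma bounded_variation_on_imp_mono_diff:
  assumes "bounded_variation_on a b h"
  obtains h1 h2 where "mono_on {a..b} h1" "mono_on {a..b} h2" "\<And>x. h x = h1 x - h2 x"
proof -
  obtain K where K: "\<And>n t. mono_on {..n} t \<Longrightarrow> t ` {..n} \<subseteq> {a..b} \<Longrightarrow>
      (\<Sum>i<n. \<bar>h (t (Suc i)) - h (t i)\<bar>) \<le> K"
    using assms unfolding bounded_variation_on_def by blast
  define P where "P = (\<lambda>x (n::nat) t. mono_on {..n} t \<and> t ` {..n} \<subseteq> {a..x})"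
  define S where "S = (\<lambda>x. {(\<Sum>i<n. \<bar>h (t (Suc i)) - h (t i)\<bar>) |n t. P x n t})"
  define V where "V = (\<lambda>x. Sup (S x))"
  have bdd: "bdd_above (S x)" if "x \<le> b" for x
    unfolding bdd_above_def
  proof (intro exI ballI)
    fix v assume "v \<in> S x"
    then obtain n t where "v = (\<Sum>i<n. \<bar>h (t (Suc i)) - h (t i)\<bar>)" "mono_on {..n} t" "t ` {..n} \<subseteq> {a..x}"
      unfolding S_def P_def by auto
    moreover have "{a..x} \<subseteq> {a..b}" using that by auto
    ultimately show "v \<le> K" using K[of n t] by blast
  qed
  \<comment> \<open>The variation between \<open>x\<close> and \<open>y\<close> dominates the
    increment of \<open>h\<close> with either sign, so this one inequality makes both
    \<open>V\<close> and \<open>V - h\<close> increasing.\<close>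
  have key: "V x + \<bar>h y - h x\<bar> \<le> V y" if xy: "a \<le> x" "x \<le> y" "y \<le> b" for x y
  proof -
    have "v \<le> V y - \<bar>h y - h x\<bar>" if v: "v \<in> S x" for v
    proof -
      obtain n t where nt: "v = (\<Sum>i<n. \<bar>h (t (Suc i)) - h (t i)\<bar>)" "mono_on {..n} t" "t ` {..n} \<subseteq> {a..x}"
        using v unfolding S_def P_def by auto
      \<comment> \<open>The chain may stop short of \<open>x\<close>, so both \<open>x\<close> and
        \<open>y\<close> are appended; chains are only weakly increasing, so repeated points do no
        harm.\<close>
      define t' where "t' = (\<lambda>i. if i \<le> n then t i else if i = Suc n then x else y)"
      have tx: "a \<le> t i \<and> t i \<le> x" if "i \<le> n" for i using nt(3) that by (auto simp: image_subset_iff)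
      have "mono_on {..Suc (Suc n)} t'"
        unfolding mono_on_def t'_def using nt(2) tx xy(2) by (force simp: mono_on_def)
      moreover have "t' ` {..Suc (Suc n)} \<subseteq> {a..y}"
        unfolding t'_def using tx xy by force
      ultimately have "(\<Sum>i<Suc (Suc n). \<bar>h (t' (Suc i)) - h (t' i)\<bar>) \<in> S y"
        unfolding S_def P_def by blast
      then have "(\<Sum>i<Suc (Suc n). \<bar>h (t' (Suc i)) - h (t' i)\<bar>) \<le> V y"
        unfolding V_def by (rule cSup_upper) (use bdd xy in auto)
      moreover have "(\<Sum>i<n. \<bar>h (t' (Suc i)) - h (t' i)\<bar>) = v"
        unfolding nt(1) t'_def by (intro sum.cong) auto
      ultimately have "v + \<bar>h x - h (t n)\<bar> + \<bar>h y - h x\<bar> \<le> V y"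
        by (simp add: t'_def)
      then show ?thesis by linarith
    qed
    moreover have "S x \<noteq> {}"
    proof -
      have "P x 0 (\<lambda>_. x)" unfolding P_def using xy by (auto simp: mono_on_def)
      then show ?thesis unfolding S_def by blast
    qed
    ultimately have "V x \<le> V y - \<bar>h y - h x\<bar>" unfolding V_def by (intro cSup_least) auto
    then show ?thesis by linarith
  qed
  have "mono_on {a..b} V"
    by (intro mono_onI) (use key in fastforce)
  moreover have "mono_on {a..b} (\<lambda>x. V x - h x)"
    by (intro mono_onI) (use key in fastforce)
  ultimately show thesis by (rule that) simp
qed

section \<open>Mixing tested on a generating family\<close>

lemma invariant_measure_funpow:
  assumes "invariant_measure M T"
  shows "T ^^ n \<in> measurable M M" "distr M M (T ^^ n) = M"
proof -
  have T: "T \<in> measurable M M" and d: "distr M M T = M"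
    using assms by (auto simp: invariant_measure_def)
  show 1: "T ^^ n \<in> measurable M M" for n
    by (rule measurable_compose_n[OF T])
  show "distr M M (T ^^ n) = M"
  proof (induction n)
    case (Suc n)
    then show ?case
      using distr_distr[OF T 1[of n]] d by (simp add: comp_def)
  qed (simp add: distr_id2 id_def)
qed

text \<open>For fixed \<open>A\<close>, the sets \<open>B\<close> with the desired limit form a
  Dynkin system. Complements use that the preimages of \<open>A\<close> all have the measure of
  \<open>A\<close>, by invariance; disjoint unions need an exchange of limit and series.\<close>

lemma (in prob_space) mixing_generatorI:
  assumes inv: "invariant_measure M T"
    and G: "Int_stable G" "G \<subseteq> Pow (space M)" "sets M = sigma_sets (space M) G"
    and lim: "\<And>A B. A \<in> sets M \<Longrightarrow> B \<in> G \<Longrightarrow>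
      (\<lambda>n. measure M (((T ^^ n) -` A \<inter> space M) \<inter> B)) \<longlonglongrightarrow> measure M A * measure M B"
  shows "mixing M T"
  unfolding mixing_def
proof (intro ballI)
  fix A B assume A: "A \<in> sets M" and B: "B \<in> sets M"
  define E where "E = (\<lambda>n. (T ^^ n) -` A \<inter> space M)"
  have E [measurable]: "E n \<in> sets M" for n
    unfolding E_def by (rule measurable_sets[OF invariant_measure_funpow(1)[OF inv] A])
  have mE: "prob (E n) = prob A" for n
    using measure_distr[OF invariant_measure_funpow(1)[OF inv, of n] A]
    unfolding E_def invariant_measure_funpow(2)[OF inv] by simp
  have "(\<lambda>n. prob (E n \<inter> B)) \<longlonglongrightarrow> prob A * prob B"
    using G(1,2) B[unfolded G(3)]
  proof (induction B rule: sigma_sets_induct_disjoint)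
    case (basic B)
    then show ?case using lim[OF A] by (simp add: E_def)
  next
    case empty
    then show ?case by simp
  next
    case (compl B)
    then have B: "B \<in> sets M" using G(3) by simp
    have "prob (E n \<inter> (space M - B)) = prob A - prob (E n \<inter> B)" for n
    proof -
      have "E n \<inter> (space M - B) = E n - E n \<inter> B"
        using sets.sets_into_space[OF E[of n]] by auto
      then show ?thesis
        using finite_measure_Diff[of "E n" "E n \<inter> B"] B mE by simp
    qed
    moreover have "(\<lambda>n. prob A - prob (E n \<inter> B)) \<longlonglongrightarrow> prob A - prob A * prob B"
      by (intro tendsto_intros compl)
    ultimately show ?case
      using B by (simp only: prob_compl right_diff_distrib mult_1_right)
  next
    case (union B)
    have B [measurable]: "B i \<in> sets M" for i using union(2) G(3) by auto
    have sB: "(\<lambda>i. prob (B i)) sums prob (\<Union>i. B i)"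
      by (rule finite_measure_UNION) (use B union(1) in auto)
    have "prob (E n \<inter> (\<Union>i. B i)) = (\<Sum>i. prob (E n \<inter> B i))" for n
    proof -
      have "(\<lambda>i. prob (E n \<inter> B i)) sums prob (\<Union>i. E n \<inter> B i)"
        by (rule finite_measure_UNION) (use B union(1) in \<open>auto simp: disjoint_family_on_def\<close>)
      then show ?thesis by (simp add: sums_iff)
    qed
    moreover have "(\<lambda>n. \<Sum>i. prob (E n \<inter> B i)) \<longlonglongrightarrow> (\<Sum>i. prob A * prob (B i))"
    \<comment> \<open>Dominated convergence for series: the terms are bounded, uniformly in
      \<open>n\<close>, by the summable \<open>prob (B i)\<close>.\<close>
    proof (rule conjunct2[OF conjunct2[OF tannerys_theorem]])
      show "summable (\<lambda>i. prob (B i))" using sB by (simp add: sums_iff)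
      show "\<forall>\<^sub>F (i, n) in sequentially \<times>\<^sub>F sequentially. norm (prob (E n \<inter> B i)) \<le> prob (B i)"
        by (intro always_eventually) (auto intro: finite_measure_mono)
    qed (use union(3) in auto)
    moreover have "(\<Sum>i. prob A * prob (B i)) = prob A * prob (\<Union>i. B i)"
      using sB suminf_mult[of "\<lambda>i. prob (B i)" "prob A"] by (simp add: sums_iff)
    ultimately show ?case by simp
  qed
  then show "(\<lambda>n. prob (((T ^^ n) -` A \<inter> space M) \<inter> B)) \<longlonglongrightarrow> prob A * prob B"
    by (simp add: E_def)
qed

text \<open>Rays are chosen as generators because they are closed under intersection and their
  indicators are increasing, hence within reach of the decay estimate.\<close>

lemma sets_unit_borel: "sets unit_borel = sigma_sets {0..1} (range (\<lambda>a. {a..} \<inter> {0..1}))"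
proof -
  have "sets (borel::real measure) = sigma_sets UNIV (range (\<lambda>x. {x..}))"
    unfolding borel_Ici by simp
  moreover from this have "{0..1::real} \<in> sigma_sets UNIV (range (\<lambda>x. {x..}))"
    by (metis atLeastAtMost_borel)
  ultimately show ?thesis
    using sigma_sets_Int[of "{0..1}" UNIV "range (\<lambda>a::real. {a..})"]
    by (simp add: sets_restrict_space image_image Int_commute)
qed

subsection \<open>Decreasing functions on the unit interval\<close>

lemma space_unit_lebesgue [simp]: "space unit_lebesgue = {0..1}"
  by (simp add: space_restrict_space)

lemma sets_unit_lebesgue: "sets unit_lebesgue = sets unit_borel"
  by (intro sets_restrict_space_cong) simp

lemma measure_unit_lebesgue_Icc:
  assumes "0 \<le> x" "x \<le> 1"
  shows "measure unit_lebesgue {0..x} = x"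
  using assms by (simp add: measure_restrict_space)

lemma prob_space_unit_lebesgue: "prob_space unit_lebesgue"
  by (intro prob_spaceI) (simp add: emeasure_restrict_space)

interpretation unit: prob_space unit_lebesgue
  by (rule prob_space_unit_lebesgue)

text \<open>Nonnegativity is imposed at the minimum and spreads by monotonicity. Values outside the
  unit interval are left free, since the limit density is controlled only inside it.\<close>

definition pos_decreasing :: "(real \<Rightarrow> real) \<Rightarrow> bool" where
  "pos_decreasing \<phi> \<longleftrightarrow> (\<forall>x y. 0 \<le> x \<longrightarrow> x \<le> y \<longrightarrow> y \<le> 1 \<longrightarrow> \<phi> y \<le> \<phi> x) \<and> 0 \<le> \<phi> 1"

lemma pos_decreasingD: "pos_decreasing \<phi> \<Longrightarrow> 0 \<le> x \<Longrightarrow> x \<le> y \<Longrightarrow> y \<le> 1 \<Longrightarrow> \<phi> y \<le> \<phi> x"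
  by (simp add: pos_decreasing_def)

lemma pos_decreasing_nonneg: "pos_decreasing \<phi> \<Longrightarrow> 0 \<le> x \<Longrightarrow> x \<le> 1 \<Longrightarrow> 0 \<le> \<phi> x"
  unfolding pos_decreasing_def by (meson order.refl order_trans)

lemma pos_decreasing_mult:
  assumes "pos_decreasing \<phi>" "pos_decreasing \<psi>"
  shows "pos_decreasing (\<lambda>x. \<phi> x * \<psi> x)"
  unfolding pos_decreasing_def
  by (auto intro!: mult_mono mult_nonneg_nonneg pos_decreasingD[OF assms(1)] pos_decreasingD[OF assms(2)]
      pos_decreasing_nonneg[OF assms(1)] pos_decreasing_nonneg[OF assms(2)])

lemma pos_decreasing_measurable:
  assumes "pos_decreasing \<phi>"
  shows "\<phi> \<in> borel_measurable unit_lebesgue"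
proof -
  have "mono_on {0..1} (\<lambda>x. - \<phi> x)"
    by (intro mono_onI) (use assms in \<open>auto simp: pos_decreasing_def\<close>)
  then have "(\<lambda>x. - \<phi> x) \<in> borel_measurable unit_borel"
    by (rule borel_measurable_mono_on_fnc)
  then have "(\<lambda>x. - \<phi> x) \<in> borel_measurable unit_lebesgue"
    using measurable_cong_sets[OF sets_unit_lebesgue refl] by blast
  then show ?thesis by simp
qed

lemma pos_decreasing_integrable:
  assumes "pos_decreasing \<phi>"
  shows "integrable unit_lebesgue \<phi>"
proof (rule unit.integrable_const_bound)
  show "AE x in unit_lebesgue. norm (\<phi> x) \<le> \<phi> 0"
    using pos_decreasing_nonneg[OF assms] pos_decreasingD[OF assms, of 0] by (intro AE_I2) auto
qed (rule pos_decreasing_measurable[OF assms])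

text \<open>Compare \<phi> with step functions: it is at least \<open>\<phi> x\<close> on
  \<open>{0..x}\<close>; it is at most \<open>\<phi> 0\<close> there and at most
  \<open>\<phi> x\<close> on the remainder, whose length is at most 1.\<close>

lemma pos_decreasing_average:
  assumes "pos_decreasing \<phi>" "0 \<le> x" "x \<le> 1"
  shows "x * \<phi> x \<le> (\<integral>w. \<phi> w \<partial>unit_lebesgue)"
    and "(\<integral>w. \<phi> w \<partial>unit_lebesgue) \<le> x * \<phi> 0 + \<phi> x"
proof -
  have ind: "(\<integral>w. indicator {0..x} w \<partial>unit_lebesgue) = x"
    using measure_unit_lebesgue_Icc[OF assms(2,3)] assms(3) by (simp add: Int_absorb2)
  have m: "integrable unit_lebesgue (indicator {0..x} :: real \<Rightarrow> real)"
    using assms(3) by (intro unit.integrable_const_bound[where B=1])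
      (auto intro!: borel_measurable_indicator simp: sets_restrict_space_iff)
  note nn = pos_decreasing_nonneg[OF assms(1)] and d = pos_decreasingD[OF assms(1)]
  have "(\<integral>w. \<phi> x * indicator {0..x} w \<partial>unit_lebesgue) \<le> (\<integral>w. \<phi> w \<partial>unit_lebesgue)"
    by (intro integral_mono integrable_mult_right m pos_decreasing_integrable assms)
      (use assms nn d in \<open>auto simp: indicator_def\<close>)
  then show "x * \<phi> x \<le> (\<integral>w. \<phi> w \<partial>unit_lebesgue)"
    by (simp only: integral_mult_right_zero ind mult.commute)
  have "(\<integral>w. \<phi> w \<partial>unit_lebesgue) \<le> (\<integral>w. \<phi> 0 * indicator {0..x} w + \<phi> x \<partial>unit_lebesgue)"
    using nn[of x] d[of 0] d[of x] assms(2,3)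
    by (intro integral_mono integrable_mult_right m pos_decreasing_integrable[OF assms(1)]
        Bochner_Integration.integrable_add)
      (auto simp: indicator_def add_increasing2)
  also have "\<dots> = (\<integral>w. \<phi> 0 * indicator {0..x} w \<partial>unit_lebesgue) + (\<integral>w. \<phi> x \<partial>unit_lebesgue)"
    by (intro Bochner_Integration.integral_add integrable_mult_right m) simp
  also have "\<dots> = x * \<phi> 0 + \<phi> x"
    using unit.prob_space by (simp only: integral_mult_right_zero ind lebesgue_integral_const scaleR_one mult.commute)
  finally show "(\<integral>w. \<phi> w \<partial>unit_lebesgue) \<le> x * \<phi> 0 + \<phi> x" .
qed

subsection \<open>The transfer operator\<close>

locale good_branches =
  fixes T :: "real \<Rightarrow> real" and r :: real
  assumes r: "1 \<le> r"
    and T_unit: "T \<in> {0..1} \<rightarrow> {0..1}"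
    and T_left: "\<And>x. 0 \<le> x \<Longrightarrow> x < 1/2 \<Longrightarrow> T x = 1 - 2 powr r * (1/2 - x) powr r"
    and T_right: "\<And>x. 1/2 \<le> x \<Longrightarrow> x \<le> 1 \<Longrightarrow> T x = 2 * x - 1"
begin

section \<open>The map in the coordinate \<open>w\<close>\<close>

definition s :: real where "s = 1 / r"

definition p :: real where "p = 2 powr (- s)"

text \<open>For \<open>r > 1\<close> the left branch of \<open>T\<close> is critical at 1/2, so its
  inverse has unbounded derivative in \<open>x\<close>; in \<open>w\<close> both inverse branches
  have bounded derivative. Orientation is reversed: \<open>w = 0\<close> is the fixed point
  \<open>x = 1\<close>.\<close>

definition coord :: "real \<Rightarrow> real" where "coord w = 1 - w powr r"

definition right_inv :: "real \<Rightarrow> real" where "right_inv v = ((1 + v) / 2) powr s"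

definition right_inv' :: "real \<Rightarrow> real" where "right_inv' v = s / 2 * ((1 + v) / 2) powr (s - 1)"

text \<open>The Perron-Frobenius operator for Lebesgue measure in \<open>w\<close>: each inverse
  branch is weighted by its derivative, \<open>p\<close> and \<open>right_inv'\<close>.\<close>

definition transfer :: "(real \<Rightarrow> real) \<Rightarrow> real \<Rightarrow> real" where
  "transfer \<phi> v = p * \<phi> (p * v) + right_inv' v * \<phi> (right_inv v)"

lemma T_in_unit: "x \<in> {0..1} \<Longrightarrow> T x \<in> {0..1}"
  using T_unit by blast

lemma s_bounds: "0 < s" "s \<le> 1"
  using r by (auto simp: s_def)

lemma p_bounds: "0 < p" "p < 1"
  using s_bounds powr_less_mono[of "-s" 0 2] by (auto simp: p_def)

lemma p_powr: "p powr r = 1 / 2"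
proof -
  have "p powr r = 2 powr (- s * r)" unfolding p_def by (rule powr_powr)
  then show ?thesis using r by (simp add: s_def powr_minus)
qed

lemma coord_unit: "w \<in> {0..1} \<Longrightarrow> coord w \<in> {0..1}"
  using r by (auto simp: coord_def intro: powr_le1)

lemma coord_antimono: "0 \<le> v \<Longrightarrow> v \<le> w \<Longrightarrow> coord w \<le> coord v"
  using r by (auto simp: coord_def intro: powr_mono2)

lemma right_inv_0: "right_inv 0 = p"
  by (simp add: right_inv_def p_def powr_divide powr_minus field_simps)

lemma right_inv_1: "right_inv 1 = 1"
  by (simp add: right_inv_def)

lemma right_inv_mono: "0 \<le> v \<Longrightarrow> v \<le> w \<Longrightarrow> right_inv v \<le> right_inv w"
  using s_bounds by (auto simp: right_inv_def intro!: powr_mono2)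

lemma right_inv_unit:
  assumes "0 \<le> v" "v \<le> 1"
  shows "p \<le> right_inv v" "0 \<le> right_inv v" "right_inv v \<le> 1"
  using right_inv_mono[of 0 v] right_inv_mono[of v 1] right_inv_0 right_inv_1 p_bounds assms by auto

lemma right_inv'_0: "right_inv' 0 = s * p"
  using powr_diff[of "1/2::real" s 1]
  by (simp add: right_inv'_def p_def powr_divide powr_minus field_simps)

lemma right_inv'_nonneg: "0 \<le> right_inv' v"
  using s_bounds by (simp add: right_inv'_def)

text \<open>The exponent \<open>s - 1\<close> is nonpositive because \<open>r \<ge> 1\<close>. This
  concavity of the inverse branch lets \<open>transfer\<close> preserve decreasing
  functions.\<close>

lemma right_inv'_antimono: "0 \<le> v \<Longrightarrow> v \<le> w \<Longrightarrow> right_inv' w \<le> right_inv' v"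
  using s_bounds by (auto simp: right_inv'_def intro!: mult_left_mono powr_mono2')

text \<open>Left and right refer to \<open>w\<close>: as \<open>coord\<close> reverses orientation,
  points \<open>p * v\<close> land in the right branch of \<open>T\<close>, including
  \<open>x = 1/2\<close> for \<open>v = 1\<close>.\<close>

lemma T_coord_left: "0 \<le> v \<Longrightarrow> v \<le> 1 \<Longrightarrow> T (coord (p * v)) = coord v"
proof -
  assume v: "0 \<le> v" "v \<le> 1"
  have "coord (p * v) = 1 - v powr r / 2"
    using p_bounds v by (simp add: coord_def powr_mult p_powr)
  moreover have "0 \<le> v powr r" "v powr r \<le> 1"
    using v r by (auto intro: powr_le1)
  ultimately show ?thesis
    using T_right[of "1 - v powr r / 2"] by (auto simp: coord_def[of v])
qed

text \<open>At \<open>v = 0\<close> the identity fails: the point is \<open>x = 1/2\<close>, which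
  \<open>T\<close> sends to 0, while \<open>coord 0 = 1\<close>.\<close>

lemma T_coord_right: "0 < v \<Longrightarrow> v \<le> 1 \<Longrightarrow> T (coord (right_inv v)) = coord v"
proof -
  assume v: "0 < v" "v \<le> 1"
  have "coord (right_inv v) = (1 - v) / 2"
    using v r by (simp add: coord_def right_inv_def s_def powr_powr field_simps)
  moreover have "2 powr r * (v / 2) powr r = v powr r"
    using powr_mult[of 2 "v / 2" r] by simp
  moreover have "1 / 2 - (1 - v) / 2 = v / 2"
    by (simp add: field_simps)
  ultimately show ?thesis
    using T_left[of "(1 - v) / 2"] v by (simp only: coord_def[of v])
qed

text \<open>Substitution along each inverse branch turns the two terms into the integrals of
  \<open>g\<close> over \<open>{0..p}\<close> and \<open>{p..1}\<close>.\<close>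

lemma transfer_integral:
  assumes g: "integrable unit_lebesgue g"
  shows "integrable unit_lebesgue (transfer g)"
    and "(\<integral>v. transfer g v \<partial>unit_lebesgue) = (\<integral>w. g w \<partial>unit_lebesgue)"
proof -
  have g01: "set_integrable lborel {0..1} g"
    using g by (simp add: integrable_restrict_space set_integrable_def)
  have gl: "set_integrable lborel {p * 0..p * 1} g" and gr: "set_integrable lborel {right_inv 0..right_inv 1} g"
    using p_bounds right_inv_0 right_inv_1 by (auto intro!: set_integrable_subset[OF g01])
  have dl: "((\<lambda>v. p * v) has_real_derivative p) (at v)" for v
    by (auto intro!: derivative_eq_intros)
  have dr: "(right_inv has_real_derivative right_inv' v) (at v)" if "v \<in> {0..1}" for v
    unfolding right_inv_def[abs_def] right_inv'_def using that
    by (auto intro!: derivative_eq_intros)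
  have cr: "continuous_on {0..1} right_inv'"
    unfolding right_inv'_def[abs_def] by (intro continuous_intros) auto
  have L1: "set_integrable lborel {0..1} (\<lambda>v. g (p * v) * p)"
    and L2: "(LBINT x. g x * indicator {p * 0..p * 1} x) = (LBINT v. g (p * v) * p * indicator {0..1} v)"
    using integral_substitution[of "\<lambda>v. p * v" 0 1 g "\<lambda>_. p"] gl dl p_bounds by auto
  have R1: "set_integrable lborel {0..1} (\<lambda>v. g (right_inv v) * right_inv' v)"
    and R2: "(LBINT x. g x * indicator {right_inv 0..right_inv 1} x)
      = (LBINT v. g (right_inv v) * right_inv' v * indicator {0..1} v)"
    using integral_substitution[OF gr dr cr] right_inv'_nonneg by auto
  have ind: "(LBINT x:A. f x) = (LBINT x. f x * indicator A x)" for A and f :: "real \<Rightarrow> real"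
    by (simp add: set_lebesgue_integral_def mult.commute)
  have t: "transfer g = (\<lambda>v. g (p * v) * p + g (right_inv v) * right_inv' v)"
    by (auto simp: transfer_def mult.commute)
  show "integrable unit_lebesgue (transfer g)"
    using set_integral_add(1)[OF L1 R1] unfolding t
    by (simp add: integrable_restrict_space set_integrable_def)
  have "(\<integral>v. transfer g v \<partial>unit_lebesgue) = (LBINT v:{0..1}. g (p * v) * p + g (right_inv v) * right_inv' v)"
    unfolding t by (simp add: integral_restrict_space set_lebesgue_integral_def)
  also have "\<dots> = (LBINT v:{0..1}. g (p * v) * p) + (LBINT v:{0..1}. g (right_inv v) * right_inv' v)"
    by (rule set_integral_add(2)[OF L1 R1])
  also have "\<dots> = (LBINT x:{0..p}. g x) + (LBINT x:{p..1}. g x)"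
    unfolding ind using L2 R2 right_inv_0 right_inv_1 by simp
  also have "\<dots> = (LBINT x:{0..p} \<union> {p..1}. g x)"
  proof (rule set_integral_Un_AE[symmetric])
    have "AE x in lborel. x \<noteq> p" by (rule AE_lborel_singleton)
    then show "AE x in lborel. \<not> (x \<in> {0..p} \<and> x \<in> {p..1})" by eventually_elim auto
  qed (use gl gr right_inv_0 right_inv_1 in auto)
  also have "{0..p} \<union> {p..1} = {0..1}"
    using p_bounds by auto
  also have "(LBINT x:{0..1}. g x) = (\<integral>w. g w \<partial>unit_lebesgue)"
    by (simp add: integral_restrict_space set_lebesgue_integral_def)
  finally show "(\<integral>v. transfer g v \<partial>unit_lebesgue) = (\<integral>w. g w \<partial>unit_lebesgue)" .
qed

section \<open>Duality between the map and its transfer operator\<close>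

lemma coord_measurable: "coord \<in> measurable unit_lebesgue unit_borel"
proof -
  have "coord \<in> borel_measurable borel"
    unfolding coord_def[abs_def] by measurable
  then have "coord \<in> measurable unit_lebesgue borel"
    by (intro measurable_restrict_space1) simp
  then show ?thesis
    using coord_unit by (intro measurable_restrict_space2) auto
qed

lemma T_measurable: "T \<in> measurable unit_borel unit_borel"
proof (rule measurable_restrict_space2)
  show "T \<in> space unit_borel \<rightarrow> {0..1}"
    using T_unit by (simp add: space_restrict_space)
  have meas: "(\<lambda>x. if x < 1/2 then 1 - 2 powr r * (1/2 - x) powr r else 2 * x - 1) \<in> borel_measurable unit_borel"
    by (intro measurable_restrict_space1) measurable
  have "T x = (if x < 1/2 then 1 - 2 powr r * (1/2 - x) powr r else 2 * x - 1)"
    if "x \<in> space unit_borel" for x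
    using that T_left[of x] T_right[of x] by (cases "x < 1/2") (simp_all add: space_restrict_space)
  with meas show "T \<in> borel_measurable unit_borel"
    by (rule measurable_cong[THEN iffD2, rotated])
qed

lemma integrable_coord_mult:
  fixes F \<phi> :: "real \<Rightarrow> real"
  assumes F: "F \<in> borel_measurable unit_borel" "\<And>x. x \<in> {0..1} \<Longrightarrow> \<bar>F x\<bar> \<le> B"
    and \<phi>: "integrable unit_lebesgue \<phi>"
  shows "integrable unit_lebesgue (\<lambda>w. F (coord w) * \<phi> w)"
proof (rule Bochner_Integration.integrable_bound[where f = "\<lambda>w. B * \<phi> w"])
  show "integrable unit_lebesgue (\<lambda>w. B * \<phi> w)" by (rule integrable_mult_right[OF \<phi>])
  have "(\<lambda>w. F (coord w)) \<in> borel_measurable unit_lebesgue"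
    by (rule measurable_compose[OF coord_measurable F(1)])
  then show "(\<lambda>w. F (coord w) * \<phi> w) \<in> borel_measurable unit_lebesgue"
    by (rule borel_measurable_times) (rule borel_measurable_integrable[OF \<phi>])
  show "AE w in unit_lebesgue. norm (F (coord w) * \<phi> w) \<le> norm (B * \<phi> w)"
  proof (rule AE_I2)
    fix w assume "w \<in> space unit_lebesgue"
    then have "\<bar>F (coord w)\<bar> \<le> \<bar>B\<bar>"
      using F(2)[OF coord_unit, of w] by simp
    then show "norm (F (coord w) * \<phi> w) \<le> norm (B * \<phi> w)"
      unfolding real_norm_def abs_mult by (rule mult_right_mono) simp
  qed
qed

text \<open>Apply preservation of the integral to the whole integrand on the left: along either
  inverse branch \<open>F (T (coord _))\<close> becomes \<open>F (coord v)\<close> and factors out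
  of \<open>transfer\<close>.\<close>

lemma transfer_duality:
  assumes F: "F \<in> borel_measurable unit_borel" "\<And>x. x \<in> {0..1} \<Longrightarrow> \<bar>F x\<bar> \<le> B"
    and \<phi>: "integrable unit_lebesgue \<phi>"
  shows "(\<integral>w. F (T (coord w)) * \<phi> w \<partial>unit_lebesgue) = (\<integral>w. F (coord w) * transfer \<phi> w \<partial>unit_lebesgue)"
proof -
  have FT: "(\<lambda>x. F (T x)) \<in> borel_measurable unit_borel"
    by (rule measurable_compose[OF T_measurable F(1)])
  have int: "integrable unit_lebesgue (\<lambda>w. F (T (coord w)) * \<phi> w)"
    by (rule integrable_coord_mult[OF FT F(2)[OF T_in_unit] \<phi>])
  have "(\<integral>w. F (T (coord w)) * \<phi> w \<partial>unit_lebesgue)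
      = (\<integral>v. transfer (\<lambda>w. F (T (coord w)) * \<phi> w) v \<partial>unit_lebesgue)"
    using transfer_integral(2)[OF int] by simp
  also have "\<dots> = (\<integral>w. F (coord w) * transfer \<phi> w \<partial>unit_lebesgue)"
  proof (rule integral_cong_AE)
    \<comment> \<open>The branch identity \<open>T_coord_right\<close> is available only for
      \<open>v > 0\<close>.\<close>
    have "AE v in lborel. (v::real) \<noteq> 0" by (rule AE_lborel_singleton)
    then have "AE v in unit_lebesgue. v \<noteq> 0"
      by (subst AE_restrict_space_iff) (auto elim: eventually_mono)
    then show "AE v in unit_lebesgue. transfer (\<lambda>w. F (T (coord w)) * \<phi> w) v = F (coord v) * transfer \<phi> v"
      using AE_space
      by eventually_elim (simp add: transfer_def T_coord_left T_coord_right, simp add: algebra_simps)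
    show "transfer (\<lambda>w. F (T (coord w)) * \<phi> w) \<in> borel_measurable unit_lebesgue"
      by (intro borel_measurable_integrable transfer_integral int)
    show "(\<lambda>w. F (coord w) * transfer \<phi> w) \<in> borel_measurable unit_lebesgue"
      by (intro borel_measurable_integrable integrable_coord_mult[OF F] transfer_integral \<phi>)
  qed
  finally show ?thesis .
qed

lemma funpow_transfer_integral:
  assumes "integrable unit_lebesgue \<phi>"
  shows "integrable unit_lebesgue ((transfer ^^ n) \<phi>)"
    and "(\<integral>w. (transfer ^^ n) \<phi> w \<partial>unit_lebesgue) = (\<integral>w. \<phi> w \<partial>unit_lebesgue)"
proof -
  have "integrable unit_lebesgue ((transfer ^^ n) \<phi>) \<and>
      (\<integral>w. (transfer ^^ n) \<phi> w \<partial>unit_lebesgue) = (\<integral>w. \<phi> w \<partial>unit_lebesgue)"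
  proof (induction n)
    case (Suc n)
    then show ?case
      using transfer_integral[of "(transfer ^^ n) \<phi>"] by simp
  qed (simp add: assms)
  then show "integrable unit_lebesgue ((transfer ^^ n) \<phi>)"
    "(\<integral>w. (transfer ^^ n) \<phi> w \<partial>unit_lebesgue) = (\<integral>w. \<phi> w \<partial>unit_lebesgue)" by auto
qed

lemma funpow_transfer_duality:
  assumes F: "F \<in> borel_measurable unit_borel" "\<And>x. x \<in> {0..1} \<Longrightarrow> \<bar>F x\<bar> \<le> B"
    and \<phi>: "integrable unit_lebesgue \<phi>"
  shows "(\<integral>w. F ((T ^^ n) (coord w)) * \<phi> w \<partial>unit_lebesgue)
    = (\<integral>w. F (coord w) * (transfer ^^ n) \<phi> w \<partial>unit_lebesgue)"
  using F
proof (induction n arbitrary: F)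
  case (Suc n)
  have FT: "(\<lambda>x. F (T x)) \<in> borel_measurable unit_borel"
    by (rule measurable_compose[OF T_measurable Suc.prems(1)])
  have "(\<integral>w. F ((T ^^ Suc n) (coord w)) * \<phi> w \<partial>unit_lebesgue)
      = (\<integral>w. F (T (coord w)) * (transfer ^^ n) \<phi> w \<partial>unit_lebesgue)"
    using Suc.IH[OF FT Suc.prems(2)[OF T_in_unit]] by simp
  also have "\<dots> = (\<integral>w. F (coord w) * (transfer ^^ Suc n) \<phi> w \<partial>unit_lebesgue)"
    using transfer_duality[OF Suc.prems funpow_transfer_integral(1)[OF \<phi>, of n]] by simp
  finally show ?case .
next
  case 0
  then show ?case by (simp only: funpow.simps id_apply)
qed

subsection \<open>Contraction on decreasing densities\<close>

text \<open>On decreasing densities the transfer operator sends the value \<open>v\<close> at \<open>0\<close> to at most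
  \<open>p * v + 1\<close>, with fixed point \<open>K\<close>. Taking \<open>C\<close> larger than \<open>K\<close> leaves room for the
  renormalisation after subtracting \<open>\<epsilon>\<close>, and for the factor \<open>2\<close> by which multiplying by an
  observable with values in \<open>{1..2}\<close> can raise \<open>\<rho> 0\<close>.\<close>

definition K :: real where "K = 1 / (1 - p)"

definition C :: real where "C = 2 * K + 2"

definition dens :: "(real \<Rightarrow> real) \<Rightarrow> bool" where
  "dens \<phi> \<longleftrightarrow> pos_decreasing \<phi> \<and> \<phi> 0 \<le> C \<and> (\<integral>w. \<phi> w \<partial>unit_lebesgue) = 1"

lemma K_pos: "0 < K"
  using p_bounds by (simp add: K_def)

lemma K_eq: "p * K + 1 = K"
  using p_bounds by (simp add: K_def field_simps)

lemma dens_bounds: "dens \<phi> \<Longrightarrow> 0 \<le> x \<Longrightarrow> x \<le> 1 \<Longrightarrow> 0 \<le> \<phi> x \<and> \<phi> x \<le> C"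
  unfolding dens_def using pos_decreasing_nonneg pos_decreasingD[of \<phi> 0 x] by fastforce

lemma dens_integrable: "dens \<phi> \<Longrightarrow> integrable unit_lebesgue \<phi>"
  by (simp add: dens_def pos_decreasing_integrable)

lemma dens_one: "dens (\<lambda>_. 1)"
  using K_pos unit.prob_space by (simp add: dens_def pos_decreasing_def C_def)

lemma transfer_pos_decreasing:
  assumes "pos_decreasing \<phi>"
  shows "pos_decreasing (transfer \<phi>)"
proof -
  have "transfer \<phi> y \<le> transfer \<phi> x" if xy: "0 \<le> x" "x \<le> y" "y \<le> 1" for x y
    unfolding transfer_def
  proof (intro add_mono mult_mono)
    have "p * x \<le> p * y" "p * y \<le> 1"
      using xy p_bounds by (auto intro: mult_left_mono mult_le_one)
    then show "\<phi> (p * y) \<le> \<phi> (p * x)"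
      using xy p_bounds by (intro pos_decreasingD[OF assms]) auto
    show "0 \<le> \<phi> (p * y)"
      using xy p_bounds \<open>p * y \<le> 1\<close> by (intro pos_decreasing_nonneg[OF assms]) auto
    show "right_inv' y \<le> right_inv' x"
      using xy by (intro right_inv'_antimono)
    show "\<phi> (right_inv y) \<le> \<phi> (right_inv x)"
      using xy right_inv_unit[of x] right_inv_unit[of y]
      by (intro pos_decreasingD[OF assms] right_inv_mono) auto
    show "0 \<le> \<phi> (right_inv y)"
      using xy right_inv_unit[of y] by (intro pos_decreasing_nonneg[OF assms]) auto
  qed (use p_bounds right_inv'_nonneg in auto)
  moreover have "0 \<le> transfer \<phi> 1"
    unfolding transfer_def using p_bounds right_inv'_nonneg right_inv_unit[of 1]
    by (intro add_nonneg_nonneg mult_nonneg_nonneg pos_decreasing_nonneg[OF assms]) auto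
  ultimately show ?thesis unfolding pos_decreasing_def by blast
qed

text \<open>At 0 the second branch contributes \<open>s * p * \<phi> p\<close>, and
  \<open>p * \<phi> p\<close> is at most the integral because \<phi> is decreasing.\<close>

lemma transfer_at_0:
  assumes "pos_decreasing \<phi>"
  shows "transfer \<phi> 0 \<le> p * \<phi> 0 + (\<integral>w. \<phi> w \<partial>unit_lebesgue)"
proof -
  have "s * (p * \<phi> p) \<le> 1 * (p * \<phi> p)"
    using s_bounds p_bounds pos_decreasing_nonneg[OF assms, of p] by (intro mult_right_mono) auto
  also have "\<dots> \<le> (\<integral>w. \<phi> w \<partial>unit_lebesgue)"
    using pos_decreasing_average(1)[OF assms, of p] p_bounds by simp
  finally show ?thesis
    by (simp add: transfer_def right_inv_0 right_inv'_0 mult.assoc)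
qed

lemma funpow_transfer_pos_decreasing: "pos_decreasing \<phi> \<Longrightarrow> pos_decreasing ((transfer ^^ n) \<phi>)"
  by (induction n) (simp_all add: transfer_pos_decreasing)

lemma funpow_transfer_at_0:
  assumes "pos_decreasing \<phi>" "(\<integral>w. \<phi> w \<partial>unit_lebesgue) = 1"
  shows "(transfer ^^ n) \<phi> 0 \<le> p ^ n * \<phi> 0 + K"
proof (induction n)
  case 0
  then show ?case using K_pos by simp
next
  case (Suc n)
  have "(transfer ^^ Suc n) \<phi> 0 \<le> p * (transfer ^^ n) \<phi> 0 + 1"
    using transfer_at_0[OF funpow_transfer_pos_decreasing[OF assms(1)], of n]
      funpow_transfer_integral(2)[OF pos_decreasing_integrable[OF assms(1)]] assms(2) by simp
  also have "\<dots> \<le> p * (p ^ n * \<phi> 0 + K) + 1"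
    using Suc p_bounds by simp
  also have "\<dots> = p ^ Suc n * \<phi> 0 + (p * K + 1)" by (simp add: algebra_simps)
  finally show ?case unfolding K_eq .
qed

text \<open>Keep only the linear branch at each step; the discarded terms are nonnegative.\<close>

lemma funpow_transfer_ge:
  assumes "pos_decreasing \<phi>" "0 \<le> x" "x \<le> 1"
  shows "p ^ n * \<phi> (p ^ n * x) \<le> (transfer ^^ n) \<phi> x"
  using assms(2,3)
proof (induction n arbitrary: x)
  case (Suc n)
  have px: "0 \<le> p * x" "p * x \<le> 1"
    using Suc.prems p_bounds by (auto intro: mult_le_one)
  have "p ^ Suc n * \<phi> (p ^ Suc n * x) = p * (p ^ n * \<phi> (p ^ n * (p * x)))"
    by (simp add: mult_ac)
  also have "\<dots> \<le> p * (transfer ^^ n) \<phi> (p * x)"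
    using Suc.IH[OF px] p_bounds by (intro mult_left_mono) auto
  also have "\<dots> \<le> (transfer ^^ Suc n) \<phi> x"
    using right_inv'_nonneg[of x] right_inv_unit[of x] Suc.prems
      pos_decreasing_nonneg[OF funpow_transfer_pos_decreasing[OF assms(1)], of "right_inv x" n]
    by (simp add: transfer_def)
  finally show ?case .
qed simp

text \<open>The constant 1 need not be fixed by \<open>transfer\<close>, but its iterates do not
  involve \<phi>. Hence a common constant part cancels when two densities are compared.\<close>

lemma funpow_transfer_affine:
  "(transfer ^^ n) (\<lambda>x. a + b * \<phi> x) = (\<lambda>x. a * (transfer ^^ n) (\<lambda>_. 1) x + b * (transfer ^^ n) \<phi> x)"
  by (induction n) (auto simp: transfer_def algebra_simps)

lemma dens_funpow_transfer:
  assumes "dens \<phi>"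
  shows "dens ((transfer ^^ n) \<phi>)"
proof -
  have "dens (transfer \<psi>)" if "dens \<psi>" for \<psi>
  proof -
    have "transfer \<psi> 0 \<le> p * C + 1"
      using transfer_at_0[of \<psi>] that mult_left_mono[of "\<psi> 0" C p, OF _ less_imp_le[OF p_bounds(1)]]
      by (simp add: dens_def)
    \<comment> \<open>The affine map \<open>v \<mapsto> p * v + 1\<close> has slope below 1 and
      fixed point \<open>K\<close>, so it does not increase any value above \<open>K\<close>, such
      as \<open>C\<close>.\<close>
    also have "\<dots> \<le> C" using K_eq p_bounds by (simp add: C_def algebra_simps)
    finally show ?thesis
      using that transfer_pos_decreasing transfer_integral(2)[OF dens_integrable[OF that]]
      by (simp add: dens_def)
  qed
  then show ?thesis using assms by (induction n) auto
qed

section \<open>Uniform lower bound and exponential contraction\<close>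

definition N :: nat where "N = (SOME n. p ^ n < 1 / (2 * C))"

text \<open>The factor \<open>p ^ N\<close> is the weight of \<open>N\<close> passes through the
  linear branch, and 1/2 is a lower bound at \<open>p ^ N\<close> for every function in
  \<open>dens\<close>.\<close>

definition \<epsilon> :: real where "\<epsilon> = p ^ N / 2"

definition \<theta> :: real where "\<theta> = 1 - \<epsilon>"

lemma p_pow_N: "p ^ N < 1 / (2 * C)"
  unfolding N_def
proof (rule someI_ex)
  show "\<exists>n. p ^ n < 1 / (2 * C)"
    using p_bounds K_pos by (intro real_arch_pow_inv) (auto simp: C_def)
qed

lemma N_pos: "0 < N"
proof (rule ccontr)
  assume "\<not> 0 < N"
  then show False using p_pow_N K_pos by (simp add: C_def field_simps)
qed

lemma C_p_pow_N: "C * p ^ N < 1 / 2"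
  using p_pow_N K_pos by (simp add: C_def field_simps)

lemma \<epsilon>_bounds: "0 < \<epsilon>" "\<epsilon> < 1 / 4" "C * \<epsilon> < 1 / 4"
proof -
  show "0 < \<epsilon>" using p_bounds by (simp add: \<epsilon>_def)
  show *: "C * \<epsilon> < 1 / 4" using C_p_pow_N by (simp add: \<epsilon>_def)
  have "1 * \<epsilon> \<le> C * \<epsilon>" using \<open>0 < \<epsilon>\<close> K_pos by (intro mult_right_mono) (auto simp: C_def)
  with * show "\<epsilon> < 1 / 4" by simp
qed

lemma \<theta>_bounds: "0 < \<theta>" "\<theta> < 1"
  using \<epsilon>_bounds by (auto simp: \<theta>_def)

text \<open>Removing \<epsilon> leaves mass \<theta>, and division by \<theta> restores a density.
  The bound \<open>C\<close> survives because after \<open>N\<close> steps the initial value at 0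
  counts for at most 1/2 beyond \<open>K\<close>.\<close>

lemma minorization:
  assumes "dens \<phi>"
  obtains \<phi>' where "dens \<phi>'" "(transfer ^^ N) \<phi> = (\<lambda>x. \<epsilon> + \<theta> * \<phi>' x)"
proof
  let ?L = "(transfer ^^ N) \<phi>"
  define \<phi>' where "\<phi>' = (\<lambda>x. (?L x - \<epsilon>) / \<theta>)"
  have pd: "pos_decreasing \<phi>" and C: "\<phi> 0 \<le> C" and I: "(\<integral>w. \<phi> w \<partial>unit_lebesgue) = 1"
    using assms by (auto simp: dens_def)
  show "?L = (\<lambda>x. \<epsilon> + \<theta> * \<phi>' x)"
    using \<theta>_bounds by (simp add: \<phi>'_def)
  have pN: "0 \<le> p ^ N" "p ^ N \<le> 1"
    using p_bounds by (auto intro: power_le_one)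
  have "p ^ N * \<phi> 0 \<le> C * p ^ N"
    using C pN mult_right_mono by (simp add: mult.commute)
  then have small: "p ^ N * \<phi> 0 \<le> 1 / 2" using C_p_pow_N by simp
  \<comment> \<open>The total mass 1 is at most \<open>p ^ N * \<phi> 0 + \<phi> (p ^ N)\<close>,
    and the first summand takes up at most half.\<close>
  then have "1 / 2 \<le> \<phi> (p ^ N)"
    using pos_decreasing_average(2)[OF pd pN] I by simp
  then have "p ^ N * (1 / 2) \<le> p ^ N * \<phi> (p ^ N)"
    using pN by (intro mult_left_mono)
  then have ge: "\<epsilon> \<le> ?L 1"
    using funpow_transfer_ge[OF pd, of 1 N] by (simp add: \<epsilon>_def)
  have pdL: "pos_decreasing ?L" by (rule funpow_transfer_pos_decreasing[OF pd])
  have "pos_decreasing \<phi>'"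
    using ge \<theta>_bounds pos_decreasingD[OF pdL]
    by (auto simp: pos_decreasing_def \<phi>'_def intro!: divide_right_mono)
  moreover have "?L 0 - \<epsilon> \<le> C * \<theta>"
    using funpow_transfer_at_0[OF pd I, of N] small \<epsilon>_bounds K_pos
    by (simp add: \<theta>_def C_def algebra_simps)
  then have "\<phi>' 0 \<le> C"
    using \<theta>_bounds by (simp add: \<phi>'_def divide_le_eq)
  moreover have "(\<integral>w. \<phi>' w \<partial>unit_lebesgue) = 1"
  proof -
    have "(\<integral>w. ?L w - \<epsilon> \<partial>unit_lebesgue) = \<theta>"
      using funpow_transfer_integral[OF pos_decreasing_integrable[OF pd], of N] I unit.prob_space
      by (subst Bochner_Integration.integral_diff) (auto simp: \<theta>_def)
    then show ?thesis using \<theta>_bounds by (simp add: \<phi>'_def)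
  qed
  ultimately show "dens \<phi>'" by (simp add: dens_def)
qed

text \<open>Every block of \<open>N\<close> steps splits off the same constant from both densities
  and leaves \<theta> times a difference of densities of the same class. An incomplete block is
  covered by the bounds 0 and \<open>C\<close>.\<close>

lemma contraction:
  assumes "dens \<phi>" "dens \<psi>" "0 \<le> x" "x \<le> 1"
  shows "\<bar>(transfer ^^ n) \<phi> x - (transfer ^^ n) \<psi> x\<bar> \<le> C * \<theta> ^ (n div N)"
  using assms(1,2)
proof (induction n arbitrary: \<phi> \<psi> rule: less_induct)
  case (less n)
  show ?case
  proof (cases "n < N")
    case True
    then show ?thesis
      using dens_bounds[OF dens_funpow_transfer[OF less.prems(1)] assms(3,4), of n]
        dens_bounds[OF dens_funpow_transfer[OF less.prems(2)] assms(3,4), of n]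
      by (simp add: abs_le_iff)
  next
    case False
    define m where "m = n - N"
    have n: "n = m + N" using False by (simp add: m_def)
    obtain \<phi>' where \<phi>': "dens \<phi>'" "(transfer ^^ N) \<phi> = (\<lambda>x. \<epsilon> + \<theta> * \<phi>' x)"
      using minorization[OF less.prems(1)] .
    obtain \<psi>' where \<psi>': "dens \<psi>'" "(transfer ^^ N) \<psi> = (\<lambda>x. \<epsilon> + \<theta> * \<psi>' x)"
      using minorization[OF less.prems(2)] .
    have "(transfer ^^ n) \<phi> x - (transfer ^^ n) \<psi> x = \<theta> * ((transfer ^^ m) \<phi>' x - (transfer ^^ m) \<psi>' x)"
      unfolding n funpow_add comp_def \<phi>'(2) \<psi>'(2) funpow_transfer_affine by (simp add: algebra_simps)
    then have "\<bar>(transfer ^^ n) \<phi> x - (transfer ^^ n) \<psi> x\<bar>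
        = \<theta> * \<bar>(transfer ^^ m) \<phi>' x - (transfer ^^ m) \<psi>' x\<bar>"
      using \<theta>_bounds by (simp add: abs_mult)
    also have "\<dots> \<le> \<theta> * (C * \<theta> ^ (m div N))"
      using less.IH[of m \<phi>' \<psi>'] \<phi>'(1) \<psi>'(1) N_pos \<theta>_bounds n by (intro mult_left_mono) auto
    also have "\<dots> = C * \<theta> ^ (n div N)"
      using N_pos by (simp add: n)
    finally show ?thesis .
  qed
qed

definition rate :: real where "rate = - ln \<theta> / N"

lemma rate_pos: "0 < rate"
  using \<theta>_bounds N_pos by (simp add: rate_def divide_neg_pos)

text \<open>By the choice of \<open>rate\<close>, \<open>exp (- rate * N)\<close> equals \<theta>.
  Rounding \<open>n / N\<close> down changes the exponent by less than one, which the division by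
  \<theta> absorbs.\<close>

lemma \<theta>_pow_le: "\<theta> ^ (n div N) \<le> exp (- rate * n) / \<theta>"
proof -
  have "n \<le> N * (n div N + 1)"
    using N_pos by (metis Suc_eq_plus1 dividend_less_times_div less_imp_le mult_Suc_right add.commute)
  then have "real n \<le> real N * real (n div N + 1)"
    by (metis of_nat_le_iff of_nat_mult)
  then have "real n / N \<le> real (n div N + 1)"
    using N_pos by (simp add: divide_le_eq mult.commute)
  then have "ln \<theta> * real (n div N + 1) \<le> ln \<theta> * (real n / N)"
    using \<theta>_bounds by (intro mult_left_mono_neg) auto
  also have "\<dots> = - rate * n" by (simp add: rate_def)
  finally have "exp (ln \<theta> * real (n div N + 1)) \<le> exp (- rate * n)" by simp
  moreover have "exp (ln \<theta> * real (n div N + 1)) = \<theta> ^ (n div N + 1)"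
    using \<theta>_bounds by (metis exp_ln exp_of_nat2_mult mult.commute)
  ultimately have "\<theta> ^ (n div N) * \<theta> \<le> exp (- rate * n)"
    by (simp only: power_add power_one_right)
  then show ?thesis
    using \<theta>_bounds by (simp only: pos_le_divide_eq)
qed

lemma exponential_contraction:
  assumes "dens \<phi>" "dens \<psi>" "0 \<le> x" "x \<le> 1"
  shows "\<bar>(transfer ^^ n) \<phi> x - (transfer ^^ n) \<psi> x\<bar> \<le> C / \<theta> * exp (- rate * n)"
proof -
  have "C * \<theta> ^ (n div N) \<le> C * (exp (- rate * n) / \<theta>)"
    using \<theta>_pow_le K_pos by (intro mult_left_mono) (auto simp: C_def)
  then show ?thesis using contraction[OF assms, of n] by simp
qed

lemma exp_rate_tendsto: "(\<lambda>n. c * exp (- rate * real n)) \<longlonglongrightarrow> 0"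
proof -
  have "(\<lambda>n. exp (- rate) ^ n) \<longlonglongrightarrow> 0"
    using rate_pos by (intro LIMSEQ_power_zero) simp
  then have "(\<lambda>n. exp (- rate * real n)) \<longlonglongrightarrow> 0"
    by (simp only: exp_of_nat2_mult)
  then show ?thesis by (rule tendsto_mult_right_zero)
qed

section \<open>The invariant density\<close>

definition \<rho> :: "real \<Rightarrow> real" where
  "\<rho> x = lim (\<lambda>n. (transfer ^^ n) (\<lambda>_. 1) x)"

lemma tendsto_\<rho>:
  assumes "0 \<le> x" "x \<le> 1"
  shows "(\<lambda>n. (transfer ^^ n) (\<lambda>_. 1) x) \<longlonglongrightarrow> \<rho> x"
proof -
  have "Cauchy (\<lambda>n. (transfer ^^ n) (\<lambda>_. 1) x)"
  proof (rule metric_CauchyI)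
    fix e :: real assume "0 < e"
    then have "\<forall>\<^sub>F n in sequentially. C / \<theta> * exp (- rate * real n) < e / 2"
      by (intro order_tendstoD(2)[OF exp_rate_tendsto] half_gt_zero)
    then obtain M where M: "C / \<theta> * exp (- rate * real M) < e / 2"
      by (auto simp: eventually_sequentially)
    have near: "dist ((transfer ^^ n) (\<lambda>_. 1) x) ((transfer ^^ M) (\<lambda>_. 1) x) < e / 2" if "M \<le> n" for n
    proof -
      \<comment> \<open>Both iterates become \<open>M\<close>-th images of functions in
        \<open>dens\<close>, so the contraction estimate applies.\<close>
      have "(transfer ^^ n) (\<lambda>_. 1) = (transfer ^^ M) ((transfer ^^ (n - M)) (\<lambda>_. 1))"
        using that by (metis comp_apply funpow_add le_add_diff_inverse)
      then show ?thesis
        using exponential_contraction[OF dens_funpow_transfer[OF dens_one] dens_one assms, of M "n - M"] M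
        unfolding dist_real_def by (simp only: le_less_trans)
    qed
    have "dist ((transfer ^^ m) (\<lambda>_. 1) x) ((transfer ^^ n) (\<lambda>_. 1) x) < e" if "M \<le> m" "M \<le> n" for m n
      by (rule dist_triangle_half_l[OF near[OF that(1)] near[OF that(2)]])
    then show "\<exists>M. \<forall>m\<ge>M. \<forall>n\<ge>M. dist ((transfer ^^ m) (\<lambda>_. 1) x) ((transfer ^^ n) (\<lambda>_. 1) x) < e"
      by blast
  qed
  then show ?thesis
    unfolding \<rho>_def using Cauchy_convergent convergent_LIMSEQ_iff by blast
qed

lemma transfer_\<rho>:
  assumes "0 \<le> x" "x \<le> 1"
  shows "transfer \<rho> x = \<rho> x"
proof (rule LIMSEQ_unique)
  have "0 \<le> p * x" "p * x \<le> 1"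
    using assms p_bounds by (auto intro: mult_le_one)
  then have "(\<lambda>n. transfer ((transfer ^^ n) (\<lambda>_. 1)) x) \<longlonglongrightarrow> transfer \<rho> x"
    unfolding transfer_def[where v = x]
    using right_inv_unit[OF assms] by (intro tendsto_intros tendsto_\<rho>)
  then show "(\<lambda>n. (transfer ^^ Suc n) (\<lambda>_. 1) x) \<longlonglongrightarrow> transfer \<rho> x" by simp
  show "(\<lambda>n. (transfer ^^ Suc n) (\<lambda>_. 1) x) \<longlonglongrightarrow> \<rho> x"
    using tendsto_\<rho>[OF assms] by (rule LIMSEQ_Suc)
qed

lemma dens_\<rho>: "dens \<rho>"
proof -
  let ?f = "\<lambda>n. (transfer ^^ n) (\<lambda>_. 1)"
  have d: "dens (?f n)" for n by (rule dens_funpow_transfer[OF dens_one])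
  have pd: "pos_decreasing \<rho>"
    unfolding pos_decreasing_def
  proof safe
    fix x y :: real assume "0 \<le> x" "x \<le> y" "y \<le> 1"
    then show "\<rho> y \<le> \<rho> x"
      using d by (intro LIMSEQ_le[OF tendsto_\<rho> tendsto_\<rho>]) (auto simp: dens_def pos_decreasing_def)
  next
    show "0 \<le> \<rho> 1"
      using dens_bounds[OF d, of 1] by (intro LIMSEQ_le_const[OF tendsto_\<rho>]) auto
  qed
  moreover have "\<rho> 0 \<le> C"
    using dens_bounds[OF d, of 0] by (intro LIMSEQ_le_const2[OF tendsto_\<rho>]) auto
  moreover have "(\<lambda>n. \<integral>w. ?f n w \<partial>unit_lebesgue) \<longlonglongrightarrow> (\<integral>w. \<rho> w \<partial>unit_lebesgue)"
  proof (rule integral_dominated_convergence[where w = "\<lambda>_. C"])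
    show "\<rho> \<in> borel_measurable unit_lebesgue" by (rule pos_decreasing_measurable[OF pd])
    show "?f n \<in> borel_measurable unit_lebesgue" for n
      using d by (simp add: dens_def pos_decreasing_measurable)
    show "AE x in unit_lebesgue. (\<lambda>n. ?f n x) \<longlonglongrightarrow> \<rho> x"
      by (rule AE_I2) (simp add: tendsto_\<rho>)
    show "AE x in unit_lebesgue. norm (?f n x) \<le> C" for n
      by (rule AE_I2) (use dens_bounds[OF d] in simp)
  qed simp
  then have "(\<integral>w. \<rho> w \<partial>unit_lebesgue) = 1"
    using d by (simp add: dens_def LIMSEQ_const_iff)
  ultimately show ?thesis by (simp add: dens_def)
qed

text \<open>The fixed-point equation improves the bound \<open>C\<close> to \<open>K\<close>, which
  leaves room for multiplying \<rho> by an observable with values up to 2.\<close>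

lemma \<rho>_at_0: "\<rho> 0 \<le> K"
proof -
  have "\<rho> 0 \<le> p * \<rho> 0 + 1"
    using transfer_at_0[of \<rho>] dens_\<rho> transfer_\<rho>[of 0] by (simp add: dens_def)
  then have "(1 - p) * \<rho> 0 \<le> 1" by (simp add: algebra_simps)
  then show ?thesis using p_bounds by (simp add: K_def pos_le_divide_eq mult.commute)
qed

text \<open>Compare with the \<open>n\<close>-th image of the \<open>m\<close>-th iterate of 1 and
  let \<open>m\<close> grow. This avoids iterating \<rho> itself, whose fixed-point equation is
  known only on the unit interval.\<close>

lemma transfer_to_\<rho>:
  assumes "dens \<phi>" "0 \<le> x" "x \<le> 1"
  shows "\<bar>(transfer ^^ n) \<phi> x - \<rho> x\<bar> \<le> C / \<theta> * exp (- rate * n)"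
proof (rule LIMSEQ_le_const2)
  have "(\<lambda>m. (transfer ^^ (m + n)) (\<lambda>_. 1) x) \<longlonglongrightarrow> \<rho> x"
    by (rule LIMSEQ_ignore_initial_segment[OF tendsto_\<rho>[OF assms(2,3)]])
  then show "(\<lambda>m. \<bar>(transfer ^^ n) \<phi> x - (transfer ^^ (m + n)) (\<lambda>_. 1) x\<bar>) \<longlonglongrightarrow> \<bar>(transfer ^^ n) \<phi> x - \<rho> x\<bar>"
    by (intro tendsto_intros)
  have "(transfer ^^ (m + n)) (\<lambda>_. 1) = (transfer ^^ n) ((transfer ^^ m) (\<lambda>_. 1))" for m
    by (metis add.commute comp_apply funpow_add)
  then show "\<exists>M. \<forall>m\<ge>M. \<bar>(transfer ^^ n) \<phi> x - (transfer ^^ (m + n)) (\<lambda>_. 1) x\<bar> \<le> C / \<theta> * exp (- rate * n)"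
    using exponential_contraction[OF assms(1) dens_funpow_transfer[OF dens_one] assms(2,3)] by simp
qed

subsection \<open>The invariant measure and decay of correlations\<close>

definition \<mu> :: "real measure" where
  "\<mu> = distr (density unit_lebesgue (\<lambda>w. ennreal (\<rho> w))) unit_borel coord"

lemma sets_\<mu> [measurable_cong]: "sets \<mu> = sets unit_borel"
  by (simp add: \<mu>_def)

lemma space_\<mu> [simp]: "space \<mu> = {0..1}"
  by (simp add: \<mu>_def space_restrict_space)

lemma pos_decreasing_\<rho>: "pos_decreasing \<rho>"
  using dens_\<rho> by (simp add: dens_def)

lemma \<rho>_nonneg: "0 \<le> x \<Longrightarrow> x \<le> 1 \<Longrightarrow> 0 \<le> \<rho> x"
  by (rule pos_decreasing_nonneg[OF pos_decreasing_\<rho>])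

lemma \<rho>_measurable: "\<rho> \<in> borel_measurable unit_lebesgue"
  by (rule pos_decreasing_measurable[OF pos_decreasing_\<rho>])

lemma coord_measurable_density: "coord \<in> measurable (density unit_lebesgue (\<lambda>w. ennreal (\<rho> w))) unit_borel"
  using coord_measurable by simp

lemma measurable_\<mu>: "measurable \<mu> M = measurable unit_borel M"
  by (rule measurable_cong_sets[OF sets_\<mu> refl])

lemma integral_\<mu>:
  fixes g :: "real \<Rightarrow> real"
  assumes "g \<in> borel_measurable unit_borel"
  shows "(\<integral>x. g x \<partial>\<mu>) = (\<integral>w. g (coord w) * \<rho> w \<partial>unit_lebesgue)"
proof -
  have "(\<integral>x. g x \<partial>\<mu>) = (\<integral>w. g (coord w) \<partial>density unit_lebesgue (\<lambda>w. ennreal (\<rho> w)))"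
    unfolding \<mu>_def by (rule integral_distr[OF coord_measurable_density assms])
  also have "\<dots> = (\<integral>w. \<rho> w *\<^sub>R g (coord w) \<partial>unit_lebesgue)"
    by (rule integral_density[OF measurable_compose[OF coord_measurable assms] \<rho>_measurable])
      (auto intro!: AE_I2 \<rho>_nonneg)
  finally show ?thesis by (simp add: mult.commute)
qed

lemma prob_space_\<mu>: "prob_space \<mu>"
proof -
  have "emeasure (density unit_lebesgue (\<lambda>w. ennreal (\<rho> w))) {0..1} = (\<integral>\<^sup>+w. ennreal (\<rho> w) \<partial>unit_lebesgue)"
    using \<rho>_measurable sets.top[of unit_lebesgue]
    by (subst emeasure_density) (auto intro!: nn_integral_cong)
  also have "\<dots> = ennreal (\<integral>w. \<rho> w \<partial>unit_lebesgue)"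
    by (rule nn_integral_eq_integral[OF dens_integrable[OF dens_\<rho>]]) (auto intro!: AE_I2 \<rho>_nonneg)
  also have "\<dots> = 1" using dens_\<rho> by (simp add: dens_def)
  finally have "prob_space (density unit_lebesgue (\<lambda>w. ennreal (\<rho> w)))"
    by (intro prob_spaceI) simp
  then show ?thesis
    unfolding \<mu>_def by (rule prob_space.prob_space_distr[OF _ coord_measurable_density])
qed

sublocale mu: prob_space \<mu> by (rule prob_space_\<mu>)

text \<open>Duality moves \<open>T\<close> from the indicator of \<open>A\<close> onto the density,
  where \<open>transfer\<close> fixes \<rho>.\<close>

lemma invariant_\<mu>: "invariant_measure \<mu> T"
proof -
  have T: "T \<in> measurable \<mu> \<mu>"
    using T_measurable measurable_cong_sets[OF sets_\<mu> sets_\<mu>] by simp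
  have "distr \<mu> \<mu> T = \<mu>"
  proof (rule measure_eqI)
    fix A assume "A \<in> sets (distr \<mu> \<mu> T)"
    then have A: "A \<in> sets \<mu>" by simp
    then have I: "(indicator A :: real \<Rightarrow> real) \<in> borel_measurable unit_borel"
      using sets_\<mu> by (intro borel_measurable_indicator) simp
    have "mu.prob (T -` A \<inter> space \<mu>) = (\<integral>x. indicator (T -` A \<inter> space \<mu>) x \<partial>\<mu>)"
      by (simp add: Int_assoc)
    also have "\<dots> = (\<integral>x. indicator A (T x) \<partial>\<mu>)"
      by (intro Bochner_Integration.integral_cong) (auto simp: indicator_def)
    also have "\<dots> = (\<integral>w. indicator A (T (coord w)) * \<rho> w \<partial>unit_lebesgue)"
      by (rule integral_\<mu>[OF measurable_compose[OF T_measurable I]])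
    also have "\<dots> = (\<integral>w. indicator A (coord w) * transfer \<rho> w \<partial>unit_lebesgue)"
      by (rule transfer_duality[OF I _ dens_integrable[OF dens_\<rho>], where B = 1]) (simp add: indicator_def)
    also have "\<dots> = (\<integral>w. indicator A (coord w) * \<rho> w \<partial>unit_lebesgue)"
      by (intro Bochner_Integration.integral_cong) (auto simp: transfer_\<rho>)
    also have "\<dots> = (\<integral>x. indicator A x \<partial>\<mu>)"
      by (rule integral_\<mu>[OF I, symmetric])
    also have "\<dots> = mu.prob A"
      using sets.sets_into_space[OF A] by (simp add: Int_absorb2)
    finally show "emeasure (distr \<mu> \<mu> T) A = emeasure \<mu> A"
      using T A by (simp add: emeasure_distr mu.emeasure_eq_measure)
  qed simp
  with T show ?thesis by (simp add: invariant_measure_def)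
qed

lemma funpow_T_measurable: "T ^^ n \<in> measurable unit_borel unit_borel"
  by (rule measurable_compose_n[OF T_measurable])

lemma funpow_T_in_unit: "x \<in> {0..1} \<Longrightarrow> (T ^^ n) x \<in> {0..1}"
  by (induction n) (simp_all only: funpow.simps comp_apply id_apply T_in_unit)

section \<open>Decay of correlations\<close>

lemma mono_on_unit_measurable:
  fixes h :: "real \<Rightarrow> real"
  shows "mono_on {0..1} h \<Longrightarrow> h \<in> borel_measurable unit_borel"
  by (rule borel_measurable_mono_on_fnc)

lemma mono_on_unit_bounded:
  fixes h :: "real \<Rightarrow> real"
  shows "mono_on {0..1} h \<Longrightarrow> x \<in> {0..1} \<Longrightarrow> \<bar>h x\<bar> \<le> \<bar>h 0\<bar> + \<bar>h 1\<bar>"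
  using mono_onD[of "{0..1}" h 0 x] mono_onD[of "{0..1}" h x 1] by auto

lemma integrable_\<mu>:
  fixes F :: "real \<Rightarrow> real"
  assumes "F \<in> borel_measurable unit_borel" "\<And>x. x \<in> {0..1} \<Longrightarrow> \<bar>F x\<bar> \<le> B"
  shows "integrable \<mu> F"
  by (rule mu.integrable_const_bound[where B = B])
    (use assms in \<open>auto intro!: AE_I2 simp: measurable_\<mu>\<close>)

lemma integral_funpow:
  fixes f :: "real \<Rightarrow> real"
  assumes "f \<in> borel_measurable unit_borel"
  shows "(\<integral>x. f ((T ^^ n) x) \<partial>\<mu>) = (\<integral>x. f x \<partial>\<mu>)"
  using integral_distr[OF invariant_measure_funpow(1)[OF invariant_\<mu>, of n], of f] assms
  by (simp add: measurable_\<mu> invariant_measure_funpow(2)[OF invariant_\<mu>])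

lemma Cor_linear:
  assumes F: "F \<in> borel_measurable unit_borel" "\<And>x. x \<in> {0..1} \<Longrightarrow> \<bar>F x\<bar> \<le> B"
    and h1: "h1 \<in> borel_measurable unit_borel" "\<And>x. x \<in> {0..1} \<Longrightarrow> \<bar>h1 x\<bar> \<le> B1"
    and h2: "h2 \<in> borel_measurable unit_borel" "\<And>x. x \<in> {0..1} \<Longrightarrow> \<bar>h2 x\<bar> \<le> B2"
  shows "Cor \<mu> T n F (\<lambda>x. a * h1 x + b * h2 x) = a * Cor \<mu> T n F h1 + b * Cor \<mu> T n F h2"
proof -
  have FT: "(\<lambda>x. F ((T ^^ n) x)) \<in> borel_measurable unit_borel"
    by (rule measurable_compose[OF funpow_T_measurable F(1)])
  have int: "integrable \<mu> (\<lambda>x. F ((T ^^ n) x) * h x)"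
    if h: "h \<in> borel_measurable unit_borel" "\<And>x. x \<in> {0..1} \<Longrightarrow> \<bar>h x\<bar> \<le> B'" for h B'
  proof (rule integrable_\<mu>)
    show "(\<lambda>x. F ((T ^^ n) x) * h x) \<in> borel_measurable unit_borel"
      by (rule borel_measurable_times[OF FT h(1)])
    fix x :: real assume x: "x \<in> {0..1}"
    show "\<bar>F ((T ^^ n) x) * h x\<bar> \<le> \<bar>B\<bar> * \<bar>B'\<bar>"
      unfolding abs_mult
      using order_trans[OF F(2)[OF funpow_T_in_unit[OF x, of n]] abs_ge_self]
        order_trans[OF h(2)[OF x] abs_ge_self] by (intro mult_mono) simp_all
  qed
  note i1 = int[OF h1] integrable_\<mu>[OF h1] and i2 = int[OF h2] integrable_\<mu>[OF h2]
  have "(\<integral>x. F ((T ^^ n) x) * (a * h1 x + b * h2 x) \<partial>\<mu>)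
      = (\<integral>x. a * (F ((T ^^ n) x) * h1 x) + b * (F ((T ^^ n) x) * h2 x) \<partial>\<mu>)"
    by (simp add: algebra_simps)
  also have "\<dots> = a * (\<integral>x. F ((T ^^ n) x) * h1 x \<partial>\<mu>) + b * (\<integral>x. F ((T ^^ n) x) * h2 x \<partial>\<mu>)"
    using i1 i2 by (subst Bochner_Integration.integral_add) auto
  finally have e: "(\<integral>x. F ((T ^^ n) x) * (a * h1 x + b * h2 x) \<partial>\<mu>)
      = a * (\<integral>x. F ((T ^^ n) x) * h1 x \<partial>\<mu>) + b * (\<integral>x. F ((T ^^ n) x) * h2 x \<partial>\<mu>)" .
  have "(\<integral>x. a * h1 x + b * h2 x \<partial>\<mu>) = a * (\<integral>x. h1 x \<partial>\<mu>) + b * (\<integral>x. h2 x \<partial>\<mu>)"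
    using i1 i2 by (subst Bochner_Integration.integral_add) auto
  with e show ?thesis by (simp add: Cor_def algebra_simps)
qed

text \<open>By invariance constants are uncorrelated with everything, so an observable may be
  shifted freely.\<close>

lemma Cor_one:
  assumes "F \<in> borel_measurable unit_borel"
  shows "Cor \<mu> T n F (\<lambda>_. 1) = 0"
  using integral_funpow[OF assms, of n] mu.prob_space by (simp add: Cor_def)

text \<open>The product of \<open>h\<close> in the coordinate \<open>w\<close> with \<rho> is
  \<open>Z\<close> times a function in \<open>dens\<close>. By duality the correlation is
  \<open>Z\<close> times the integral of \<open>F\<close> against the distance of its iterates from
  \<rho>.\<close>

lemma Cor_decay_normalized:
  assumes F: "F \<in> borel_measurable unit_borel" "\<And>x. x \<in> {0..1} \<Longrightarrow> \<bar>F x\<bar> \<le> B"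
    and h: "mono_on {0..1} h" "1 \<le> h 0" "h 1 \<le> 2"
  shows "\<exists>D. \<forall>n. \<bar>Cor \<mu> T n F h\<bar> \<le> D * exp (- rate * real n)"
proof -
  define \<phi>0 where "\<phi>0 = (\<lambda>w. h (coord w) * \<rho> w)"
  define Z where "Z = (\<integral>w. \<phi>0 w \<partial>unit_lebesgue)"
  define \<phi> where "\<phi> = (\<lambda>w. \<phi>0 w / Z)"
  have hb: "1 \<le> h x \<and> h x \<le> 2" if "x \<in> {0..1}" for x
    using mono_onD[OF h(1), of 0 x] mono_onD[OF h(1), of x 1] h(2,3) that by auto
  have "pos_decreasing (\<lambda>w. h (coord w))"
    unfolding pos_decreasing_def
  proof safe
    fix x y :: real assume xy: "0 \<le> x" "x \<le> y" "y \<le> 1"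
    then show "h (coord y) \<le> h (coord x)"
      using coord_unit[of x] coord_unit[of y] by (intro mono_onD[OF h(1)] coord_antimono) auto
  next
    show "0 \<le> h (coord 1)" using hb[OF coord_unit, of 1] by simp
  qed
  then have pd: "pos_decreasing \<phi>0"
    unfolding \<phi>0_def by (intro pos_decreasing_mult pos_decreasing_\<rho>)
  have "(\<integral>w. \<rho> w \<partial>unit_lebesgue) \<le> Z"
    unfolding Z_def
  proof (intro integral_mono dens_integrable[OF dens_\<rho>] pos_decreasing_integrable[OF pd])
    fix w assume "w \<in> space unit_lebesgue"
    then show "\<rho> w \<le> \<phi>0 w"
      using hb[OF coord_unit, of w] \<rho>_nonneg[of w] mult_right_mono[of 1 "h (coord w)" "\<rho> w"]
      by (simp add: \<phi>0_def)
  qed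
  then have Z: "1 \<le> Z" using dens_\<rho> by (simp add: dens_def)
  have "dens \<phi>"
    unfolding dens_def
  proof (intro conjI)
    show "pos_decreasing \<phi>"
      using pd Z by (auto simp: pos_decreasing_def \<phi>_def intro!: divide_right_mono)
    \<comment> \<open>This uses the sharper bound on \<open>\<rho> 0\<close>; dividing by
      \<open>Z \<ge> 1\<close> cannot increase the value, and \<open>C\<close> exceeds
      \<open>2 * K\<close>.\<close>
    have "\<phi>0 0 \<le> 2 * K"
      unfolding \<phi>0_def using hb[OF coord_unit, of 0] \<rho>_at_0 \<rho>_nonneg[of 0] K_pos
      by (intro mult_mono) auto
    moreover have "\<phi>0 0 / Z \<le> \<phi>0 0"
      using Z pos_decreasing_nonneg[OF pd, of 0] by (simp add: divide_le_eq mult_le_cancel_left1)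
    ultimately show "\<phi> 0 \<le> C" by (simp add: \<phi>_def C_def)
    show "(\<integral>w. \<phi> w \<partial>unit_lebesgue) = 1" using Z by (simp add: \<phi>_def Z_def[symmetric])
  qed
  note \<phi>_int = dens_integrable[OF \<open>dens \<phi>\<close>]
  have bound: "\<bar>Cor \<mu> T n F h\<bar> \<le> Z * (B * (C / \<theta> * exp (- rate * real n)))" for n
  proof -
    let ?L = "(transfer ^^ n) \<phi>"
    have hm: "h \<in> borel_measurable unit_borel" by (rule mono_on_unit_measurable[OF h(1)])
    have FT: "(\<lambda>x. F ((T ^^ n) x)) \<in> borel_measurable unit_borel"
      by (rule measurable_compose[OF funpow_T_measurable F(1)])
    have i1: "integrable unit_lebesgue (\<lambda>w. F (coord w) * ?L w)"
      by (rule integrable_coord_mult[OF F funpow_transfer_integral(1)[OF \<phi>_int]])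
    have i2: "integrable unit_lebesgue (\<lambda>w. F (coord w) * \<rho> w)"
      by (rule integrable_coord_mult[OF F dens_integrable[OF dens_\<rho>]])
    have "(\<integral>x. F ((T ^^ n) x) * h x \<partial>\<mu>) = (\<integral>w. F ((T ^^ n) (coord w)) * h (coord w) * \<rho> w \<partial>unit_lebesgue)"
      by (rule integral_\<mu>[OF borel_measurable_times[OF FT hm]])
    also have "\<dots> = (\<integral>w. Z * (F ((T ^^ n) (coord w)) * \<phi> w) \<partial>unit_lebesgue)"
      using Z by (intro Bochner_Integration.integral_cong) (auto simp: \<phi>_def \<phi>0_def)
    also have "\<dots> = Z * (\<integral>w. F (coord w) * ?L w \<partial>unit_lebesgue)"
      using funpow_transfer_duality[OF F \<phi>_int, of n] by simp
    finally have "(\<integral>x. F ((T ^^ n) x) * h x \<partial>\<mu>) = Z * (\<integral>w. F (coord w) * ?L w \<partial>unit_lebesgue)" .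
    moreover have "(\<integral>x. h x \<partial>\<mu>) = Z"
      using integral_\<mu>[OF hm] by (simp add: Z_def \<phi>0_def)
    ultimately have "Cor \<mu> T n F h
        = Z * ((\<integral>w. F (coord w) * ?L w \<partial>unit_lebesgue) - (\<integral>w. F (coord w) * \<rho> w \<partial>unit_lebesgue))"
      using integral_\<mu>[OF F(1)] by (simp add: Cor_def algebra_simps)
    also have "\<dots> = Z * (\<integral>w. F (coord w) * ?L w - F (coord w) * \<rho> w \<partial>unit_lebesgue)"
      by (simp only: Bochner_Integration.integral_diff[OF i1 i2])
    finally have "\<bar>Cor \<mu> T n F h\<bar> = Z * \<bar>\<integral>w. F (coord w) * ?L w - F (coord w) * \<rho> w \<partial>unit_lebesgue\<bar>"
      using Z by (simp add: abs_mult)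
    also have "\<dots> \<le> Z * (B * (C / \<theta> * exp (- rate * real n)))"
    proof (intro mult_left_mono order_trans[OF integral_abs_bound] unit.integral_le_const)
      show "0 \<le> Z" using Z by simp
      show "integrable unit_lebesgue (\<lambda>w. \<bar>F (coord w) * ?L w - F (coord w) * \<rho> w\<bar>)"
        by (intro integrable_abs Bochner_Integration.integrable_diff i1 i2)
      show "AE w in unit_lebesgue. \<bar>F (coord w) * ?L w - F (coord w) * \<rho> w\<bar> \<le> B * (C / \<theta> * exp (- rate * real n))"
      proof (rule AE_I2)
        fix w assume "w \<in> space unit_lebesgue"
        then have w: "w \<in> {0..1}" by simp
        have "\<bar>F (coord w)\<bar> * \<bar>?L w - \<rho> w\<bar> \<le> B * (C / \<theta> * exp (- rate * real n))"
          using F(2)[OF coord_unit[OF w]] transfer_to_\<rho>[OF \<open>dens \<phi>\<close>, of w n] w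
          by (intro mult_mono) auto
        then show "\<bar>F (coord w) * ?L w - F (coord w) * \<rho> w\<bar> \<le> B * (C / \<theta> * exp (- rate * real n))"
          by (simp only: right_diff_distrib[symmetric] abs_mult)
      qed
    qed
    finally show ?thesis .
  qed
  show ?thesis
    by (rule exI[of _ "Z * (B * (C / \<theta>))"]) (use bound in \<open>simp add: mult_ac\<close>)
qed

lemma Cor_decay_mono:
  assumes F: "F \<in> borel_measurable unit_borel" "\<And>x. x \<in> {0..1} \<Longrightarrow> \<bar>F x\<bar> \<le> B"
    and h: "mono_on {0..1} h"
  shows "\<exists>D. \<forall>n. \<bar>Cor \<mu> T n F h\<bar> \<le> D * exp (- rate * real n)"
proof -
  \<comment> \<open>The summand 1 keeps the divisor positive when \<open>h\<close> is constant; the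
    rescaled function takes values between 1 and 2.\<close>
  define \<alpha> where "\<alpha> = h 1 - h 0 + 1"
  define h' where "h' = (\<lambda>x. 1 + (h x - h 0) / \<alpha>)"
  have \<alpha>: "1 \<le> \<alpha>" using mono_onD[OF h, of 0 1] by (simp add: \<alpha>_def)
  have mono: "mono_on {0..1} h'"
    unfolding h'_def using \<alpha> mono_onD[OF h] by (auto intro!: mono_onI divide_right_mono)
  have "1 \<le> h' 0" "h' 1 \<le> 2" using \<alpha> by (auto simp: h'_def \<alpha>_def divide_le_eq)
  then obtain D where D: "\<And>n. \<bar>Cor \<mu> T n F h'\<bar> \<le> D * exp (- rate * real n)"
    using Cor_decay_normalized[OF F mono] by blast
  have "h = (\<lambda>x. \<alpha> * h' x + (h 0 - \<alpha>) * 1)"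
    using \<alpha> by (simp add: h'_def field_simps)
  then have "Cor \<mu> T n F h = \<alpha> * Cor \<mu> T n F h'" for n
    using Cor_linear[OF F mono_on_unit_measurable[OF mono] mono_on_unit_bounded[OF mono],
        of "\<lambda>_. 1" 1 n \<alpha> "h 0 - \<alpha>"] Cor_one[OF F(1), of n] by simp
  then have "\<bar>Cor \<mu> T n F h\<bar> \<le> (\<alpha> * D) * exp (- rate * real n)" for n
    using D[of n] \<alpha> by (simp add: abs_mult mult.assoc)
  then show ?thesis by blast
qed

lemma Cor_decay_bounded_variation:
  assumes F: "F \<in> borel_measurable unit_borel" "\<And>x. x \<in> {0..1} \<Longrightarrow> \<bar>F x\<bar> \<le> B"
    and h: "bounded_variation_on 0 1 h"
  shows "\<exists>D. \<forall>n. \<bar>Cor \<mu> T n F h\<bar> \<le> D * exp (- rate * real n)"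
proof -
  obtain h1 h2 where m: "mono_on {0..1} h1" "mono_on {0..1} h2" and h12: "\<And>x. h x = h1 x - h2 x"
    using bounded_variation_on_imp_mono_diff[OF h] by blast
  obtain D1 D2 where D: "\<And>n. \<bar>Cor \<mu> T n F h1\<bar> \<le> D1 * exp (- rate * real n)"
      "\<And>n. \<bar>Cor \<mu> T n F h2\<bar> \<le> D2 * exp (- rate * real n)"
    using Cor_decay_mono[OF F m(1)] Cor_decay_mono[OF F m(2)] by blast
  have "h = (\<lambda>x. 1 * h1 x + (- 1) * h2 x)" using h12 by auto
  then have "Cor \<mu> T n F h = Cor \<mu> T n F h1 - Cor \<mu> T n F h2" for n
    using Cor_linear[OF F mono_on_unit_measurable[OF m(1)] mono_on_unit_bounded[OF m(1)]
        mono_on_unit_measurable[OF m(2)] mono_on_unit_bounded[OF m(2)], of n 1 "- 1"] by simp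
  then have "\<bar>Cor \<mu> T n F h\<bar> \<le> (D1 + D2) * exp (- rate * real n)" for n
    using D(1)[of n] D(2)[of n] order_trans[OF abs_triangle_ineq4 add_mono]
    by (simp only: distrib_right)
  then show ?thesis by blast
qed

lemma Cor_decay_Linfty:
  assumes f: "in_Linfty \<mu> f" and h: "bounded_variation_on 0 1 h"
  shows "\<exists>D. \<forall>n. \<bar>Cor \<mu> T n f h\<bar> \<le> D * exp (- rate * real n)"
proof -
  have fm: "f \<in> borel_measurable unit_borel" and ess: "esssup \<mu> (\<lambda>x. ereal \<bar>f x\<bar>) < \<infinity>"
    using f by (auto simp: in_Linfty_def measurable_\<mu>)
  obtain B where B: "esssup \<mu> (\<lambda>x. ereal \<bar>f x\<bar>) \<le> ereal B"
    using ess by (cases "esssup \<mu> (\<lambda>x. ereal \<bar>f x\<bar>)") auto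
  \<comment> \<open>The preceding estimates ask for a bound at every point, so \<mu>-null
    exceptional values are replaced by 0.\<close>
  define F where "F = (\<lambda>x. if \<bar>f x\<bar> \<le> B then f x else 0)"
  have Fm: "F \<in> borel_measurable unit_borel"
    unfolding F_def using fm by measurable
  have Fb: "\<bar>F x\<bar> \<le> max 0 B" for x by (auto simp: F_def)
  have eq: "AE x in \<mu>. f x = F x"
    using esssup_AE[where M = \<mu> and f = "\<lambda>x. ereal \<bar>f x\<bar>"]
  proof eventually_elim
    case (elim x)
    then have "ereal \<bar>f x\<bar> \<le> ereal B" using B by (rule order_trans)
    then show ?case by (simp add: F_def)
  qed
  have hm: "h \<in> borel_measurable unit_borel"
  proof -
    obtain h1 h2 where m: "mono_on {0..1} h1" "mono_on {0..1} h2" and h12: "\<And>x. h x = h1 x - h2 x"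
      using bounded_variation_on_imp_mono_diff[OF h] by blast
    have "(\<lambda>x. h1 x - h2 x) \<in> borel_measurable unit_borel"
      by (intro borel_measurable_diff mono_on_unit_measurable m)
    then show ?thesis by (simp add: h12[symmetric])
  qed
  have "Cor \<mu> T n f h = Cor \<mu> T n F h" for n
  proof -
    note Tn = invariant_measure_funpow[OF invariant_\<mu>, of n]
    \<comment> \<open>Invariance carries the almost everywhere equality over to the compositions
      with \<open>T ^^ n\<close>.\<close>
    have "AE x in distr \<mu> \<mu> (T ^^ n). f x = F x" unfolding Tn(2) by (rule eq)
    moreover have "{x \<in> space \<mu>. f x = F x} \<in> sets \<mu>"
      using fm Fm by (intro borel_measurable_eq) (auto simp: measurable_\<mu>)
    ultimately have ae: "AE x in \<mu>. f ((T ^^ n) x) = F ((T ^^ n) x)"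
      using AE_distr_iff[OF Tn(1)] by simp
    have "(\<integral>x. f ((T ^^ n) x) * h x \<partial>\<mu>) = (\<integral>x. F ((T ^^ n) x) * h x \<partial>\<mu>)"
      by (rule integral_cong_AE)
        (use ae in \<open>auto simp: measurable_\<mu> elim: eventually_mono
          intro!: borel_measurable_times hm measurable_compose[OF funpow_T_measurable] fm Fm\<close>)
    moreover have "(\<integral>x. f x \<partial>\<mu>) = (\<integral>x. F x \<partial>\<mu>)"
      by (rule integral_cong_AE) (use eq fm Fm in \<open>auto simp: measurable_\<mu>\<close>)
    ultimately show ?thesis by (simp add: Cor_def)
  qed
  then show ?thesis using Cor_decay_bounded_variation[OF Fm Fb h] by simp
qed

section \<open>Mixing and absolute continuity\<close>

lemma mixing_\<mu>: "mixing \<mu> T"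
proof (rule mu.mixing_generatorI[OF invariant_\<mu>])
  let ?G = "range (\<lambda>a::real. {a..} \<inter> {0..1})"
  show "Int_stable ?G"
  proof (rule Int_stableI_image)
    fix a b :: real
    have "{a..} \<inter> {0..1} \<inter> ({b..} \<inter> {0..1}) = {max a b..} \<inter> {0..1}" by auto
    then show "\<exists>c\<in>UNIV. {a..} \<inter> {0..1} \<inter> ({b..} \<inter> {0..1}) = {c..} \<inter> {0..1}" by blast
  qed
  show "?G \<subseteq> Pow (space \<mu>)" by auto
  show "sets \<mu> = sigma_sets (space \<mu>) ?G"
    using sets_\<mu> sets_unit_borel by simp
  fix A B assume A: "A \<in> sets \<mu>" and "B \<in> ?G"
  then obtain a where B: "B = {a..} \<inter> {0..1}" by auto
  have Bs: "B \<in> sets \<mu>" using B sets_\<mu> by (auto simp: sets_restrict_space)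
  let ?f = "indicator A :: real \<Rightarrow> real" and ?h = "indicator {a..} :: real \<Rightarrow> real"
  have I: "?f \<in> borel_measurable unit_borel"
    using A sets_\<mu> by (intro borel_measurable_indicator) simp
  have "mono_on {0..1} ?h" by (intro mono_onI) (auto simp: indicator_def)
  then obtain D where D: "\<And>n. \<bar>Cor \<mu> T n ?f ?h\<bar> \<le> D * exp (- rate * real n)"
    using Cor_decay_mono[OF I, of 1] by (auto simp: indicator_def)
  have int: "(\<integral>x. indicator E x \<partial>\<mu>) = mu.prob E" if "E \<in> sets \<mu>" for E
    using sets.sets_into_space[OF that] by (simp add: Int_absorb2)
  \<comment> \<open>For indicators the correlation is exactly the mixing defect, and the indicator
    of a ray is increasing.\<close>
  have "Cor \<mu> T n ?f ?h = mu.prob (((T ^^ n) -` A \<inter> space \<mu>) \<inter> B) - mu.prob A * mu.prob B" for n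
  proof -
    have "(T ^^ n) -` A \<inter> space \<mu> \<inter> B \<in> sets \<mu>"
      using measurable_sets[OF invariant_measure_funpow(1)[OF invariant_\<mu>] A] Bs by blast
    note int[OF this, symmetric]
    also have "(\<integral>x. indicator ((T ^^ n) -` A \<inter> space \<mu> \<inter> B) x \<partial>\<mu>) = (\<integral>x. ?f ((T ^^ n) x) * ?h x \<partial>\<mu>)"
      by (intro Bochner_Integration.integral_cong) (auto simp: indicator_def B)
    finally have 1: "mu.prob ((T ^^ n) -` A \<inter> space \<mu> \<inter> B) = (\<integral>x. ?f ((T ^^ n) x) * ?h x \<partial>\<mu>)" .
    have "mu.prob B = (\<integral>x. indicator B x \<partial>\<mu>)" by (rule int[OF Bs, symmetric])
    also have "\<dots> = (\<integral>x. ?h x \<partial>\<mu>)"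
      by (intro Bochner_Integration.integral_cong) (auto simp: indicator_def B)
    finally show ?thesis unfolding Cor_def 1 int[OF A] by simp
  qed
  moreover have "(\<lambda>n. Cor \<mu> T n ?f ?h) \<longlonglongrightarrow> 0"
    by (rule Lim_null_comparison[OF _ exp_rate_tendsto[of D]]) (use D in \<open>auto intro!: always_eventually\<close>)
  ultimately show "(\<lambda>n. mu.prob (((T ^^ n) -` A \<inter> space \<mu>) \<inter> B)) \<longlonglongrightarrow> mu.prob A * mu.prob B"
    by (subst Lim_null) simp
qed

text \<open>The preimage of a null set under \<open>coord\<close> is null: away from
  \<open>x = 1\<close> the inverse \<open>(1 - x) powr s\<close> is differentiable and so maps null
  sets to null sets, and \<open>x = 1\<close> adds only the point \<open>w = 0\<close>.\<close>

lemma absolutely_continuous_\<mu>: "absolutely_continuous unit_lebesgue \<mu>"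
  unfolding absolutely_continuous_def
proof
  fix A assume A: "A \<in> null_sets unit_lebesgue"
  then have A': "A \<subseteq> {0..1}" "A \<in> null_sets lborel" by (auto simp: null_sets_restrict_space)
  have As: "A \<in> sets unit_borel" using A sets_unit_lebesgue by auto
  define E where "E = coord -` A \<inter> {0..1}"
  have Es: "E \<in> sets unit_lebesgue"
    using measurable_sets[OF coord_measurable As] by (simp add: E_def)
  have "negligible ((\<lambda>x. (1 - x) powr s) ` (A - {1}))"
  proof (rule negligible_differentiable_image_negligible)
    have "negligible A"
      using A'(2) by (simp add: negligible_iff_null_sets null_sets_completionI)
    then show "negligible (A - {1})"
      by (rule negligible_subset) auto
    show "(\<lambda>x. (1 - x) powr s) differentiable_on (A - {1})"
      unfolding differentiable_on_def
    proof
      fix x assume "x \<in> A - {1}"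
      then have "((\<lambda>x. (1 - x) powr s) has_real_derivative (- s * (1 - x) powr (s - 1))) (at x within A - {1})"
        using A'(1) by (auto intro!: derivative_eq_intros)
      then show "(\<lambda>x. (1 - x) powr s) differentiable (at x within A - {1})"
        by (auto simp: has_field_derivative_def intro: differentiableI)
    qed
  qed simp
  then have "negligible (insert 0 ((\<lambda>x. (1 - x) powr s) ` (A - {1})))" by simp
  moreover have "E \<subseteq> insert 0 ((\<lambda>x. (1 - x) powr s) ` (A - {1}))"
  proof
    fix w assume w: "w \<in> E"
    have "w = (1 - coord w) powr s" if "w \<noteq> 0"
      using w r that by (simp add: E_def coord_def s_def powr_powr)
    moreover have "coord w \<noteq> 1" if "w \<noteq> 0"
      using that by (simp add: coord_def)
    ultimately show "w \<in> insert 0 ((\<lambda>x. (1 - x) powr s) ` (A - {1}))"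
      using w by (auto simp: E_def)
  qed
  ultimately have "E \<in> null_sets (completion lborel)"
    using negligible_subset negligible_iff_null_sets by blast
  moreover have "E \<in> sets lborel" using Es by (auto simp: sets_restrict_space)
  ultimately have "E \<in> null_sets lborel" by (simp add: null_sets_completion_iff)
  then have "E \<in> null_sets unit_lebesgue"
    by (simp add: null_sets_restrict_space E_def)
  then have "AE w in unit_lebesgue. w \<notin> E" by (rule AE_not_in)
  then have "E \<in> null_sets (density unit_lebesgue (\<lambda>w. ennreal (\<rho> w)))"
    using Es \<rho>_measurable by (subst null_sets_density_iff) (auto elim: eventually_mono)
  then show "A \<in> null_sets \<mu>"
    unfolding \<mu>_def using As by (subst null_sets_distr_iff[OF coord_measurable_density]) (simp add: E_def)
qed

end

theorem corollary1p1:
  fixes T :: "real \<Rightarrow> real"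
  assumes "good_map T"
  shows "\<exists>\<mu> :: real measure.
      sets \<mu> = sets unit_borel \<and> prob_space \<mu> \<and> invariant_measure \<mu> T \<and>
      mixing \<mu> T \<and> absolutely_continuous unit_lebesgue \<mu> \<and>
      (\<exists>a>0. \<forall>f h. in_Linfty \<mu> f \<longrightarrow> bounded_variation_on 0 1 h \<longrightarrow>
         (\<lambda>n. \<bar>Cor \<mu> T n f h\<bar>) \<in> O(\<lambda>n. exp (- a * real n)))"
proof -
  obtain r where "1 \<le> r"
    and "\<forall>x\<in>{0..<1/2}. T x = 1 - 2 powr r * (1/2 - x) powr r" "\<forall>x\<in>{1/2..1}. T x = 2 * x - 1"
    and "T \<in> {0..1} \<rightarrow> {0..1}"
    using assms unfolding good_map_def by blast
  then interpret good_branches T r by unfold_locales auto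
  \<comment> \<open>The exponent \<open>rate\<close> is determined by \<open>r\<close> alone; only
    the constant \<open>D\<close> varies with \<open>f\<close> and \<open>h\<close>.\<close>
  have "(\<lambda>n. \<bar>Cor \<mu> T n f h\<bar>) \<in> O(\<lambda>n. exp (- rate * real n))"
    if fh: "in_Linfty \<mu> f" "bounded_variation_on 0 1 h" for f h
  proof -
    obtain D where "\<And>n. \<bar>Cor \<mu> T n f h\<bar> \<le> D * exp (- rate * real n)"
      using Cor_decay_Linfty[OF fh] by blast
    then show ?thesis by (intro bigoI[of _ D] always_eventually) simp
  qed
  then show ?thesis
    using sets_\<mu> prob_space_\<mu> invariant_\<mu> mixing_\<mu> absolutely_continuous_\<mu> rate_pos
    by (intro exI[of _ \<mu>]) blast
qed

end
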